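(* Let $K\ge2$ be an integer, $\beta>0$, $\boldsymbol{\alpha}=(\alpha_1,\ldots,\alpha_K)$ with $\alpha_i>0$, $\theta=|\boldsymbol{\alpha}|$, and let $(Z_{1,t},\ldots,Z_{K,t})$, $t\ge0$, have independent components, $Z_{i,t}$ being a Cox--Ingersoll--Ross process with generator $\mathcal{B}_if(z_i)=\frac12(\alpha_i-\beta z_i)f'(z_i)+\frac12z_if''(z_i)$. Let $\psi_t$ be the associated prediction operator. Then for all $\mathbf{m}\in\mathbb{Z}_+^K$, $s\ge0$ and $t\ge0$, $$\psi_t\big(\mathbf{Ga}(\boldsymbol{\alpha}+\mathbf{m},\beta+s)\big)=\sum_{i=0}^{|\mathbf{m}|}\mathrm{Bin}(|\mathbf{m}|-i;|\mathbf{m}|,p(t))\,\mathrm{Ga}(\theta+|\mathbf{m}|-i,\beta+S_t)\sum_{\mathbf{0}\le\mathbf{i}\le\mathbf{m},\,|\mathbf{i}|=i}p(\mathbf{i};\mathbf{m},i)\,\pi_{\boldsymbol{\alpha}+\mathbf{m}-\mathbf{i}},$$ where $$p(t)=\frac{\beta}{(\beta+s)e^{\beta t/2}-s},\qquad S_t=\frac{\beta s}{(\beta+s)e^{\beta t/2}-s},\qquad S_0=s,$$ and $p(\mathbf{i};\mathbf{m},i)=\binom{|\mathbf{m}|}{i}^{-1}\prod_{j=1}^K\binom{m_j}{i_j}$ is the multivariate hypergeometric probability function.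
   Context: Notation: $\mathbb{Z}_+=\{0,1,\ldots\}$; $|\mathbf{m}|=\sum_jm_j$; inequalities between vectors are componentwise. $\mathrm{Ga}(a,b)$ is the gamma distribution with shape $a$ and rate $b$; $\mathbf{Ga}(\boldsymbol{\alpha},\beta)=\mathrm{Ga}(\alpha_1,\beta)\times\cdots\times\mathrm{Ga}(\alpha_K,\beta)$ is the product measure on $\mathbb{R}_+^K$; $\mathrm{Bin}(k;n,p)=\binom nkp^k(1-p)^{n-k}$; $\pi_{\mathbf{a}}$ is the Dirichlet distribution on the simplex $\{\mathbf{x}\in[0,1]^K:\sum_ix_i=1\}$ with parameter $\mathbf{a}$. A product $\mathrm{Ga}(a,b)\,\pi_{\mathbf{a}}$ denotes the law on $\mathbb{R}_+^K$ of $\mathbf{z}=r\mathbf{x}$ with $r\sim\mathrm{Ga}(a,b)$ and $\mathbf{x}\sim\pi_{\mathbf{a}}$ independent (so $|\mathbf{z}|=r$, $\mathbf{z}/|\mathbf{z}|=\mathbf{x}$). The CIR generator $\mathcal{B}_i$ acts on $C^2([0,\infty))$ functions vanishing at infinity; the process is reversible with respect to $\mathrm{Ga}(\alpha_i,\beta)$. Prediction operator: if $P_t(\mathbf{z},d\mathbf{z}')$ is the transition kernel of the joint process, $\psi_t(\nu)(d\mathbf{z}')=\int\nu(d\mathbf{z})P_t(\mathbf{z},d\mathbf{z}')$. *)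

theory Defs
  imports "HOL-Probability.Probability"
begin

section \<open>State spaces and elementary distributions\<close>

definition half_line :: "real measure" where
  "half_line = restrict_space borel {0..}"

definition orthant :: "nat \<Rightarrow> (nat \<Rightarrow> real) measure" where
  "orthant K = (\<Pi>\<^sub>M j\<in>{1..K}. half_line)"

definition gamma_dist :: "real \<Rightarrow> real \<Rightarrow> real measure" where
  "gamma_dist a b = density (restrict_space lborel {0..})
     (\<lambda>x. ennreal (b powr a / Gamma a * x powr (a - 1) * exp (- b * x)))"

definition gamma_product :: "nat \<Rightarrow> (nat \<Rightarrow> real) \<Rightarrow> real \<Rightarrow> (nat \<Rightarrow> real) measure" where
  "gamma_product K a b = (\<Pi>\<^sub>M j\<in>{1..K}. gamma_dist (a j) b)"

text \<open>The Dirichlet distribution is given by its usual density with respect to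
  Lebesgue measure in the first \<open>K - 1\<close> coordinates; the last coordinate is
  determined by the sum being one.\<close>

definition open_simplex :: "nat \<Rightarrow> (nat \<Rightarrow> real) set" where
  "open_simplex K = {x. (\<forall>j\<in>{1..<K}. 0 < x j) \<and> (\<Sum>j\<in>{1..<K}. x j) < 1}"

definition simplex_point :: "nat \<Rightarrow> (nat \<Rightarrow> real) \<Rightarrow> nat \<Rightarrow> real" where
  "simplex_point K x = (\<lambda>j\<in>{1..K}. if j = K then 1 - (\<Sum>l\<in>{1..<K}. x l) else x j)"

definition dirichlet :: "nat \<Rightarrow> (nat \<Rightarrow> real) \<Rightarrow> (nat \<Rightarrow> real) measure" where
  "dirichlet K a = distr
     (density (restrict_space (\<Pi>\<^sub>M j\<in>{1..<K}. lborel) (open_simplex K))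
       (\<lambda>x. ennreal (Gamma (\<Sum>j\<in>{1..K}. a j) / (\<Prod>j\<in>{1..K}. Gamma (a j))
               * (\<Prod>j\<in>{1..K}. simplex_point K x j powr (a j - 1)))))
     (orthant K) (simplex_point K)"

text \<open>The law of \<open>r x\<close> for independent \<open>r\<close> with law \<open>Ga(a, b)\<close> and \<open>x\<close> with law \<open>\<nu>\<close>.\<close>

definition gamma_times :: "nat \<Rightarrow> real \<Rightarrow> real \<Rightarrow> (nat \<Rightarrow> real) measure \<Rightarrow> (nat \<Rightarrow> real) measure" where
  "gamma_times K a b \<nu> =
     distr (gamma_dist a b \<Otimes>\<^sub>M \<nu>) (orthant K) (\<lambda>(r, x). \<lambda>j\<in>{1..K}. r * x j)"

text \<open>The linear combination \<open>\<Sum>i\<in>I. w i \<cdot> \<mu> i\<close> of measures on the measurable space of \<open>N\<close>.\<close>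

definition mixture :: "'a measure \<Rightarrow> 'i set \<Rightarrow> ('i \<Rightarrow> real) \<Rightarrow> ('i \<Rightarrow> 'a measure) \<Rightarrow> 'a measure" where
  "mixture N I w \<mu> =
     measure_of (space N) (sets N) (\<lambda>A. \<Sum>i\<in>I. ennreal (w i) * emeasure (\<mu> i) A)"

definition binomial_prob :: "nat \<Rightarrow> nat \<Rightarrow> real \<Rightarrow> real" where
  "binomial_prob k n p = real (n choose k) * p ^ k * (1 - p) ^ (n - k)"

text \<open>The vectors \<open>i\<close> with \<open>0 \<le> i \<le> m\<close> and \<open>|i| = n\<close>.\<close>

definition subvectors :: "nat \<Rightarrow> (nat \<Rightarrow> nat) \<Rightarrow> nat \<Rightarrow> (nat \<Rightarrow> nat) set" where
  "subvectors K m n = {i \<in> (\<Pi>\<^sub>E j\<in>{1..K}. {0..m j}). (\<Sum>j\<in>{1..K}. i j) = n}"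

definition hypergeom_prob :: "nat \<Rightarrow> (nat \<Rightarrow> nat) \<Rightarrow> (nat \<Rightarrow> nat) \<Rightarrow> nat \<Rightarrow> real" where
  "hypergeom_prob K i m n =
     (\<Prod>j\<in>{1..K}. real (m j choose i j)) / real ((\<Sum>j\<in>{1..K}. m j) choose n)"

section \<open>Cox--Ingersoll--Ross processes\<close>

text \<open>\<open>C\<^sub>0([0,\<infinity>))\<close>; values of a function at negative arguments are never used.\<close>

definition C0 :: "(real \<Rightarrow> real) set" where
  "C0 = {f. continuous_on {0..} f \<and> (f \<longlongrightarrow> 0) at_top}"

definition feller_semigroup :: "(real \<Rightarrow> real \<Rightarrow> real measure) \<Rightarrow> bool" where
  "feller_semigroup P \<longleftrightarrow>
     (\<forall>t\<ge>0. P t \<in> half_line \<rightarrow>\<^sub>M prob_algebra half_line) \<and>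
     (\<forall>x\<ge>0. P 0 x = return half_line x) \<and>
     (\<forall>s\<ge>0. \<forall>t\<ge>0. \<forall>x\<ge>0. P (s + t) x = P s x \<bind> P t) \<and>
     (\<forall>f\<in>C0. \<forall>t\<ge>0. (\<lambda>x. \<integral>y. f y \<partial>P t x) \<in> C0) \<and>
     (\<forall>f\<in>C0. uniform_limit {0..} (\<lambda>h x. \<integral>y. f y \<partial>P h x) f (at_right 0))"

text \<open>The graph of the infinitesimal generator on \<open>C\<^sub>0([0,\<infinity>))\<close> with the supremum norm.\<close>

definition generator :: "(real \<Rightarrow> real \<Rightarrow> real measure) \<Rightarrow> ((real \<Rightarrow> real) \<times> (real \<Rightarrow> real)) set" where
  "generator P = {(f, g). f \<in> C0 \<and> g \<in> C0 \<and>
     uniform_limit {0..} (\<lambda>h x. ((\<integral>y. f y \<partial>P h x) - f x) / h) g (at_right 0)}"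

text \<open>The graph of the operator \<open>B f(z) = (\<alpha> - \<beta> z) f'(z) / 2 + z f''(z) / 2\<close> on the functions
  \<open>f \<in> C\<^sup>2([0,\<infinity>))\<close> such that \<open>f\<close> and \<open>B f\<close> vanish at infinity. Derivatives at \<open>0\<close> are
  one-sided; since \<open>f\<close> is smooth up to the boundary, this operator also determines
  the (instantaneously reflecting) behaviour at \<open>0\<close> when \<open>\<alpha> < 1\<close>.\<close>

definition cir_operator :: "real \<Rightarrow> real \<Rightarrow> ((real \<Rightarrow> real) \<times> (real \<Rightarrow> real)) set" where
  "cir_operator \<alpha> \<beta> = {(f, g). f \<in> C0 \<and> g \<in> C0 \<and>
     (\<exists>f' f''.
        (\<forall>x\<ge>0. (f has_real_derivative f' x) (at x within {0..})) \<and>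
        (\<forall>x\<ge>0. (f' has_real_derivative f'' x) (at x within {0..})) \<and>
        continuous_on {0..} f'' \<and>
        (\<forall>x\<ge>0. g x = 1/2 * (\<alpha> - \<beta> * x) * f' x + 1/2 * x * f'' x))}"

text \<open>The operator above is defined on a core, so inclusion in the generator
  determines the semigroup.\<close>

definition cir_semigroup :: "real \<Rightarrow> real \<Rightarrow> (real \<Rightarrow> real \<Rightarrow> real measure) \<Rightarrow> bool" where
  "cir_semigroup \<alpha> \<beta> P \<longleftrightarrow> feller_semigroup P \<and> cir_operator \<alpha> \<beta> \<subseteq> generator P"

definition history :: "'w measure \<Rightarrow> (real \<Rightarrow> 'w \<Rightarrow> real) \<Rightarrow> real \<Rightarrow> 'w measure" where
  "history M Z s =
     sigma (space M) (\<Union>u\<in>{0..s}. {Z u -` A \<inter> space M | A. A \<in> sets half_line})"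

definition markov_process ::
  "'w measure \<Rightarrow> (real \<Rightarrow> 'w \<Rightarrow> real) \<Rightarrow> (real \<Rightarrow> real \<Rightarrow> real measure) \<Rightarrow> bool" where
  "markov_process M Z P \<longleftrightarrow>
     prob_space M \<and>
     (\<forall>t\<ge>0. Z t \<in> M \<rightarrow>\<^sub>M half_line) \<and>
     (\<forall>s\<ge>0. \<forall>t\<ge>0. \<forall>A\<in>sets half_line. AE \<omega> in M.
        real_cond_exp M (history M Z s) (\<lambda>\<omega>. indicator A (Z (s + t) \<omega>)) \<omega>
          = measure (P t (Z s \<omega>)) A)"

definition cir_process ::
  "real \<Rightarrow> real \<Rightarrow> real \<Rightarrow> 'w measure \<Rightarrow> (real \<Rightarrow> 'w \<Rightarrow> real) \<Rightarrow> bool" where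
  "cir_process \<alpha> \<beta> z M Z \<longleftrightarrow>
     (\<exists>P. cir_semigroup \<alpha> \<beta> P \<and> markov_process M Z P) \<and> (AE \<omega> in M. Z 0 \<omega> = z)"

text \<open>\<open>M z\<close> is the probability measure under which the process starts at \<open>z\<close>.
  Independence is that of the entire paths of the components.\<close>

definition independent_cir_processes ::
  "nat \<Rightarrow> (nat \<Rightarrow> real) \<Rightarrow> real \<Rightarrow> ((nat \<Rightarrow> real) \<Rightarrow> 'w measure) \<Rightarrow> (nat \<Rightarrow> real \<Rightarrow> 'w \<Rightarrow> real) \<Rightarrow> bool"
  where
  "independent_cir_processes K \<alpha> \<beta> M Z \<longleftrightarrow>
     (\<forall>z\<in>space (orthant K).
        prob_space (M z) \<and>
        (\<forall>j\<in>{1..K}. cir_process (\<alpha> j) \<beta> (z j) (M z) (Z j)) \<and>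
        prob_space.indep_vars (M z) (\<lambda>_. \<Pi>\<^sub>M t\<in>{0..}. half_line)
          (\<lambda>j \<omega>. \<lambda>t\<in>{0..}. Z j t \<omega>) {1..K})"

definition transition_kernel ::
  "nat \<Rightarrow> ((nat \<Rightarrow> real) \<Rightarrow> 'w measure) \<Rightarrow> (nat \<Rightarrow> real \<Rightarrow> 'w \<Rightarrow> real) \<Rightarrow> real
     \<Rightarrow> (nat \<Rightarrow> real) \<Rightarrow> (nat \<Rightarrow> real) measure" where
  "transition_kernel K M Z t z = distr (M z) (orthant K) (\<lambda>\<omega>. \<lambda>j\<in>{1..K}. Z j t \<omega>)"

definition prediction ::
  "nat \<Rightarrow> ((nat \<Rightarrow> real) \<Rightarrow> 'w measure) \<Rightarrow> (nat \<Rightarrow> real \<Rightarrow> 'w \<Rightarrow> real) \<Rightarrow> real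
     \<Rightarrow> (nat \<Rightarrow> real) measure \<Rightarrow> (nat \<Rightarrow> real) measure" where
  "prediction K M Z t \<nu> = \<nu> \<bind> transition_kernel K M Z t"

definition p_coeff :: "real \<Rightarrow> real \<Rightarrow> real \<Rightarrow> real" where
  "p_coeff \<beta> s t = \<beta> / ((\<beta> + s) * exp (\<beta> * t / 2) - s)"

definition S_coeff :: "real \<Rightarrow> real \<Rightarrow> real \<Rightarrow> real" where
  "S_coeff \<beta> s t = \<beta> * s / ((\<beta> + s) * exp (\<beta> * t / 2) - s)"

lemma S_coeff_0: "\<beta> > 0 \<Longrightarrow> S_coeff \<beta> s 0 = s"
  by (simp add: S_coeff_def)

end

theory Submission
  imports Defs
begin

text \<open>For a CIR semigroup the functions \<open>z \<mapsto> exp (- c z)\<close> evolve explicitly under the generator: they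
  stay exponentials, with a prefactor and an exponent solving a Riccati equation. Uniqueness for
  the Cauchy problem of a Feller semigroup therefore gives the Laplace transform of the transition
  kernel, hence the kernel itself. Applied to a one-dimensional gamma law, the Laplace transform
  factorizes as \<open>q\<^sup>\<alpha> (p q + 1 - p)\<^sup>m\<close> with \<open>q\<close> the transform of an exponential law, and the
  binomial theorem turns this into a binomial mixture of gamma laws. By independence the prediction
  of a product of gamma laws is the product of these mixtures. Expanding the product and collecting
  the terms with \<open>|i| = i\<close> produces the binomial and hypergeometric weights, and a product of gamma
  laws with a common rate is \<open>Ga(|a|, b) \<pi>\<^sub>a\<close> by the substitution \<open>z = r x\<close>.\<close>

section \<open>Laplace transforms on the half-line\<close>

text \<open>The definition of the joint process hides a quantifier: each starting point
  \<open>z\<close> and each component comes with its own existentially quantified semigroup.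
  Uniqueness of the kernel replaces them all by one semigroup \<open>Q j\<close> per component. Only
  then is the joint kernel visibly measurable in \<open>z\<close>, so that the bind in
  \<open>prediction\<close> can be evaluated. A semigroup is accessible only through the inclusion
  of the differential operator in its generator, that is, through one-sided limits in the supremum
  norm. Hence the error bounds uniform in the space variable and the constancy criterion with a
  right derivative. The coefficients have a common origin. Let D =
  \<open>cir_den \<beta> c t\<close>, b = \<beta> + S_t and q = b / (b + c). Averaging the kernel's
  transform over Ga(\<alpha> + m, \<beta> + s) gives D^(-\<alpha>) (D q)^(\<alpha> + m), so the
  power \<alpha> of D cancels and q^\<alpha> (D q)^m remains. The values p(t) and S_t are such that
  D q = p q + 1 - p for every c.\<close>

lemma space_half_line [simp]: "space half_line = {0..}"
  by (simp add: half_line_def space_restrict_space)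

lemma measurable_half_line_borel:
  assumes "f \<in> borel_measurable borel" shows "f \<in> borel_measurable half_line"
  using assms by (simp add: half_line_def measurable_restrict_space1)

lemma measurable_half_lineI:
  assumes "f \<in> borel_measurable M" "\<And>x. x \<in> space M \<Longrightarrow> f x \<ge> 0"
  shows "f \<in> M \<rightarrow>\<^sub>M half_line"
  unfolding half_line_def by (rule measurable_restrict_space2) (use assms in auto)

text \<open>On [0,1] all absolute moments are at most 1. The two characteristic functions therefore
  share their Taylor polynomial of degree \<open>n\<close> with remainders of order |t|^n / n!,
  which tend to 0 for every \<open>t\<close>, and Levy's uniqueness theorem applies.\<close>

lemma real_distribution_eqI_moments:
  assumes "real_distribution M" "real_distribution N"
    and "AE y in M. 0 \<le> y \<and> y \<le> 1" "AE y in N. 0 \<le> y \<and> y \<le> 1"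
    and "\<And>k::nat. (\<integral>y. y ^ k \<partial>M) = (\<integral>y. y ^ k \<partial>N)"
  shows "M = N"
proof -
  interpret M: real_distribution M by fact
  interpret N: real_distribution N by fact
  have int: "integrable Q (\<lambda>y. y ^ k)" and le: "(\<integral>y. \<bar>y\<bar> ^ k \<partial>Q) \<le> 1"
    if "real_distribution Q" "AE y in Q. 0 \<le> y \<and> y \<le> 1" for Q k
  proof -
    interpret Q: real_distribution Q by fact
    have b: "AE y in Q. norm (y ^ k) \<le> 1"
      using that(2) by eventually_elim (simp add: power_abs[symmetric] power_le_one)
    show int: "integrable Q (\<lambda>y. y ^ k)"
      using b by (intro Q.integrable_const_bound[of _ 1]) auto
    have "(\<integral>y. \<bar>y\<bar> ^ k \<partial>Q) \<le> (\<integral>y. 1 \<partial>Q)"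
      using b integrable_norm[OF int] by (intro integral_mono_AE) (auto simp: power_abs)
    then show "(\<integral>y. \<bar>y\<bar> ^ k \<partial>Q) \<le> 1" using Q.prob_space by simp
  qed
  have "char M t = char N t" for t
  proof -
    have bound: "cmod (char M t - char N t) \<le> 4 * (\<bar>t\<bar> ^ n / fact n)" for n
    proof -
      define a where "a = (\<Sum>k\<le>n. ((\<i> * t)^k / fact k) * M.expectation (\<lambda>x. x^k))"
      have c: "2 * \<bar>t\<bar> ^ n / fact n * e \<le> 2 * \<bar>t\<bar> ^ n / fact n" if "e \<le> 1" for e :: real
        using mult_left_mono[OF that, of "2 * \<bar>t\<bar> ^ n / fact n"] by simp
      have "cmod (char M t - a) \<le> 2 * \<bar>t\<bar> ^ n / fact n"
        unfolding a_def
        by (rule order_trans[OF M.char_approx1 c]) (use assms int le in auto)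
      moreover have "cmod (char N t - a) \<le> 2 * \<bar>t\<bar> ^ n / fact n"
        unfolding a_def assms(5)
        by (rule order_trans[OF N.char_approx1 c]) (use assms int le in auto)
      moreover have "cmod (char M t - char N t) \<le> cmod (char M t - a) + cmod (char N t - a)"
        using norm_triangle_ineq4[of "char M t - a" "char N t - a"] by simp
      ultimately show ?thesis by simp
    qed
    have "(\<lambda>n. \<bar>t\<bar> ^ n / fact n) \<longlonglongrightarrow> 0"
      using summable_LIMSEQ_zero[OF summable_exp[of "\<bar>t\<bar>"]] by (simp add: divide_inverse mult.commute)
    then have "(\<lambda>n. 4 * (\<bar>t\<bar> ^ n / fact n)) \<longlonglongrightarrow> 4 * 0"
      by (intro tendsto_mult tendsto_const)
    then have "(\<lambda>n::nat. char M t - char N t) \<longlonglongrightarrow> 0"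
      by (intro Lim_null_comparison[of "\<lambda>n. char M t - char N t"]) (use bound in auto)
    then show ?thesis by (simp add: LIMSEQ_const_iff)
  qed
  then show ?thesis by (intro Levy_uniqueness assms) auto
qed

text \<open>Under \<open>y = exp (- x)\<close> the Laplace transform at the integers becomes the sequence of moments.\<close>

lemma half_line_eqI_laplace:
  assumes "prob_space M" "prob_space N" and sets: "sets M = sets half_line" "sets N = sets half_line"
    and L: "\<And>c. c > 0 \<Longrightarrow> (\<integral>\<^sup>+x. ennreal (exp (- c * x)) \<partial>M) = (\<integral>\<^sup>+x. ennreal (exp (- c * x)) \<partial>N)"
  shows "M = N"
proof -
  have meas: "(\<lambda>x. exp (- x)) \<in> borel_measurable Q" if "sets Q = sets half_line" for Q :: "real measure"
    unfolding measurable_cong_sets[OF that refl] by (rule measurable_half_line_borel) simp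
  have D: "real_distribution (distr Q borel (\<lambda>x. exp (- x)))"
    and AE: "AE y in distr Q borel (\<lambda>x. exp (- x)). 0 \<le> y \<and> y \<le> 1"
    and inv: "distr (distr Q borel (\<lambda>x. exp (- x))) half_line (\<lambda>y. max 0 (- ln y)) = Q"
    and mom: "(\<integral>y. y ^ k \<partial>distr Q borel (\<lambda>x. exp (- x))) = (\<integral>x. exp (- real k * x) \<partial>Q)"
    if Q: "prob_space Q" "sets Q = sets half_line" for Q k
  proof -
    interpret Q: prob_space Q by fact
    note [measurable] = meas[OF Q(2)]
    have sp: "space Q = {0..}" using sets_eq_imp_space_eq[OF Q(2)] by simp
    show "real_distribution (distr Q borel (\<lambda>x. exp (- x)))"
      by (intro Q.real_distribution_distr) simp
    show "AE y in distr Q borel (\<lambda>x. exp (- x)). 0 \<le> y \<and> y \<le> 1"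
      by (subst AE_distr_iff) (auto simp: sp)
    \<comment> \<open>The inverse of x -> exp (- x) is - ln; the \<open>max 0\<close> makes it map
      all reals into the half-line without changing it on (0,1].\<close>
    have [measurable]: "(\<lambda>y. max 0 (- ln y)) \<in> borel \<rightarrow>\<^sub>M half_line"
      by (rule measurable_half_lineI) auto
    have "distr (distr Q borel (\<lambda>x. exp (- x))) half_line (\<lambda>y. max 0 (- ln y))
        = distr Q half_line ((\<lambda>y. max 0 (- ln y)) \<circ> (\<lambda>x. exp (- x)))"
      by (rule distr_distr) auto
    also have "\<dots> = distr Q half_line (\<lambda>x. x)"
      by (rule distr_cong) (auto simp: sp)
    also have "\<dots> = Q" by (rule distr_id2) (simp add: Q)
    finally show "distr (distr Q borel (\<lambda>x. exp (- x))) half_line (\<lambda>y. max 0 (- ln y)) = Q" .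
    show "(\<integral>y. y ^ k \<partial>distr Q borel (\<lambda>x. exp (- x))) = (\<integral>x. exp (- real k * x) \<partial>Q)"
      by (subst integral_distr) (simp_all add: exp_of_nat_mult[symmetric])
  qed
  have lap: "(\<integral>x. exp (- c * x) \<partial>Q) = enn2real (\<integral>\<^sup>+x. ennreal (exp (- c * x)) \<partial>Q)"
    if "sets Q = sets half_line" for Q and c :: real
  proof (rule integral_eq_nn_integral)
    show "(\<lambda>x. exp (- c * x)) \<in> borel_measurable Q"
      unfolding measurable_cong_sets[OF that refl] by (rule measurable_half_line_borel) simp
  qed simp
  have "distr M borel (\<lambda>x. exp (- x)) = distr N borel (\<lambda>x. exp (- x))"
  proof (rule real_distribution_eqI_moments)
    fix k :: nat
    have "(\<integral>x. exp (- real k * x) \<partial>M) = (\<integral>x. exp (- real k * x) \<partial>N)"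
    \<comment> \<open>The hypothesis concerns positive \<open>c\<close> only; the zeroth moment is
      the total mass, which is 1 on both sides.\<close>
    proof (cases "k = 0")
      case True
      then show ?thesis using prob_space.prob_space[OF assms(1)] prob_space.prob_space[OF assms(2)]
        by simp
    next
      case False
      then show ?thesis unfolding lap[OF sets(1)] lap[OF sets(2)] using L[of "real k"] by simp
    qed
    then show "(\<integral>y. y ^ k \<partial>distr M borel (\<lambda>x. exp (- x))) = (\<integral>y. y ^ k \<partial>distr N borel (\<lambda>x. exp (- x)))"
      by (simp only: mom[OF assms(1) sets(1)] mom[OF assms(2) sets(2)])
  qed (fact D[OF assms(1) sets(1)] D[OF assms(2) sets(2)] AE[OF assms(1) sets(1)] AE[OF assms(2) sets(2)])+
  then have "distr (distr M borel (\<lambda>x. exp (- x))) half_line (\<lambda>y. max 0 (- ln y))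
    = distr (distr N borel (\<lambda>x. exp (- x))) half_line (\<lambda>y. max 0 (- ln y))"
    by (rule arg_cong)
  then show ?thesis by (simp only: inv[OF assms(1) sets(1)] inv[OF assms(2) sets(2)])
qed

section \<open>Feller semigroups\<close>

text \<open>Continuous induction with slope \<open>e\<close>: let \<open>c\<close> be the supremum
  of the points up to which \<open>F\<close> stays within \<open>e * (r - a)\<close> of
  \<open>F a\<close>. Left continuity carries the bound to \<open>c\<close> itself, and the
  vanishing right derivative carries it beyond \<open>c\<close> unless \<open>c = b\<close>. Then
  \<open>e\<close> tends to 0. The one-sided form fits generators, which provide limits for positive
  time steps only.\<close>

lemma zero_right_derivative_imp_const:
  fixes F :: "real \<Rightarrow> real"
  assumes "a \<le> b"
    and right: "\<And>s e. a \<le> s \<Longrightarrow> s < b \<Longrightarrow> e > 0 \<Longrightarrow> \<forall>\<^sub>F h in at_right 0. \<bar>F (s + h) - F s\<bar> \<le> e * h"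
    and left: "\<And>s. a < s \<Longrightarrow> s \<le> b \<Longrightarrow> ((\<lambda>h. F (s - h)) \<longlongrightarrow> F s) (at_right 0)"
  shows "F b = F a"
proof -
  have *: "\<bar>F b - F a\<bar> \<le> e * (b - a)" if e: "e > 0" for e
  proof -
    define S where "S = {s \<in> {a..b}. \<forall>r\<in>{a..s}. \<bar>F r - F a\<bar> \<le> e * (r - a)}"
    define c where "c = Sup S"
    have aS: "a \<in> S" using \<open>a \<le> b\<close> by (auto simp: S_def)
    have bdd: "bdd_above S" by (rule bdd_aboveI[of _ b]) (auto simp: S_def)
    have ac: "a \<le> c" using cSup_upper[OF aS bdd] by (simp add: c_def)
    have cb: "c \<le> b" unfolding c_def by (rule cSup_least) (use aS in \<open>auto simp: S_def\<close>)
    have below: "\<bar>F r - F a\<bar> \<le> e * (r - a)" if "a \<le> r" "r < c" for r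
    proof -
      have "S \<noteq> {}" "r < Sup S" using aS that by (auto simp: c_def)
      then have "\<exists>s\<in>S. r < s" by (simp add: less_cSup_iff bdd)
      then obtain s where "s \<in> S" "r < s" by auto
      then show ?thesis using that by (auto simp: S_def)
    qed
    have at: "\<bar>F c - F a\<bar> \<le> e * (c - a)"
    proof (cases "c = a")
      case False
      then have "a < c" using ac by simp
      have "((\<lambda>h. \<bar>F (c - h) - F a\<bar>) \<longlongrightarrow> \<bar>F c - F a\<bar>) (at_right 0)"
        by (intro tendsto_intros left) (use \<open>a < c\<close> cb in auto)
      moreover have "((\<lambda>h. e * (c - h - a)) \<longlongrightarrow> e * (c - 0 - a)) (at_right 0)"
        by (intro tendsto_intros)
      moreover have "\<forall>\<^sub>F h in at_right 0. \<bar>F (c - h) - F a\<bar> \<le> e * (c - h - a)"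
        unfolding eventually_at_right_field
        by (rule exI[of _ "c - a"]) (use \<open>a < c\<close> below in auto)
      ultimately show ?thesis
        using tendsto_le[of "at_right (0::real)"] by simp
    qed auto
    have "c = b"
    proof (rule ccontr)
      assume "c \<noteq> b"
      then have "c < b" using cb by simp
      from right[OF ac this e] obtain d where d: "d > 0"
        "\<And>h. 0 < h \<Longrightarrow> h < d \<Longrightarrow> \<bar>F (c + h) - F c\<bar> \<le> e * h"
        by (auto simp: eventually_at_right_field)
      \<comment> \<open>Strictly to the right of \<open>c\<close>, inside the range
        \<open>c + d\<close> of the local estimate, and not beyond \<open>b\<close>.\<close>
      define s where "s = c + min (d / 2) (b - c)"
      have s: "c < s" "s \<le> b" "s < c + d" using d \<open>c < b\<close> by (auto simp: s_def min_def)
      have "\<bar>F r - F a\<bar> \<le> e * (r - a)" if "r \<in> {a..s}" for r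
      proof (cases r c rule: linorder_cases)
        case greater
        then have "\<bar>F r - F c\<bar> \<le> e * (r - c)" using d(2)[of "r - c"] that s by auto
        then have "\<bar>F r - F a\<bar> \<le> e * (r - c) + e * (c - a)" using at by linarith
        then show ?thesis by (simp add: algebra_simps)
      qed (use below at that in auto)
      then have "s \<in> S" using s ac by (auto simp: S_def)
      then have "s \<le> c" unfolding c_def by (rule cSup_upper) (rule bdd)
      then show False using s by simp
    qed
    then show ?thesis using at by simp
  qed
  have "\<bar>F b - F a\<bar> \<le> 0"
  proof (rule field_le_epsilon)
    fix e :: real assume "e > 0"
    \<comment> \<open>The added 1 keeps the denominator positive when \<open>a = b\<close>.\<close>
    then have "\<bar>F b - F a\<bar> \<le> e / (b - a + 1) * (b - a)" using \<open>a \<le> b\<close> by (intro *) auto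
    also have "\<dots> \<le> e" using \<open>a \<le> b\<close> \<open>e > 0\<close> by (simp add: field_simps)
    finally show "\<bar>F b - F a\<bar> \<le> 0 + e" by simp
  qed
  then show ?thesis by simp
qed

lemma C0_measurable: "f \<in> C0 \<Longrightarrow> f \<in> borel_measurable half_line"
  by (simp add: C0_def half_line_def borel_measurable_continuous_on_restrict)

lemma C0_bounded:
  assumes "f \<in> C0"
  shows "\<exists>B. \<forall>x\<ge>0. \<bar>f x\<bar> \<le> B"
proof -
  have "(f \<longlongrightarrow> 0) at_top" using assms by (simp add: C0_def)
  from tendstoD[OF this, of 1] have "\<forall>\<^sub>F x in at_top. \<bar>f x\<bar> < 1" by simp
  then obtain N where N: "\<And>x. x \<ge> N \<Longrightarrow> \<bar>f x\<bar> < 1" by (auto simp: eventually_at_top_linorder)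
  have "compact (f ` {0..N})"
    by (rule compact_continuous_image) (use assms in \<open>auto simp: C0_def intro: continuous_on_subset\<close>)
  then obtain B where B: "\<forall>x\<in>{0..N}. \<bar>f x\<bar> \<le> B"
    by (auto simp: bounded_iff dest!: compact_imp_bounded)
  have "\<bar>f x\<bar> \<le> max B 1" if "x \<ge> 0" for x
    using N[of x] B that by (cases "x \<le> N") (auto simp: le_max_iff_disj)
  then show ?thesis by blast
qed

context
  fixes P assumes P: "feller_semigroup P"
begin

lemma feller_prob_algebra: "t \<ge> 0 \<Longrightarrow> P t \<in> half_line \<rightarrow>\<^sub>M prob_algebra half_line"
  using P by (simp add: feller_semigroup_def)

lemma feller_prob:
  assumes "t \<ge> 0" "x \<ge> 0"
  shows "prob_space (P t x)" "sets (P t x) = sets half_line" "space (P t x) = {0..}"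
proof -
  have "P t x \<in> space (prob_algebra half_line)"
    using measurable_space[OF feller_prob_algebra[OF assms(1)], of x] assms(2) by simp
  then show "prob_space (P t x)" and *: "sets (P t x) = sets half_line"
    by (auto simp: space_prob_algebra)
  show "space (P t x) = {0..}" using sets_eq_imp_space_eq[OF *] by simp
qed

lemma feller_integrable:
  assumes "t \<ge> 0" "x \<ge> 0" "f \<in> C0"
  shows "integrable (P t x) f"
proof -
  interpret prob_space "P t x" by (rule feller_prob) fact+
  obtain B where "\<And>x. x \<ge> 0 \<Longrightarrow> \<bar>f x\<bar> \<le> B" using C0_bounded[OF assms(3)] by blast
  moreover have "f \<in> borel_measurable (P t x)"
    using C0_measurable[OF assms(3)] measurable_cong_sets[OF feller_prob(2)[OF assms(1,2)] refl] by blast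
  ultimately show ?thesis
    by (intro integrable_const_bound[of _ B]) (auto simp: feller_prob(3)[OF assms(1,2)])
qed

lemma feller_integral_C0: "t \<ge> 0 \<Longrightarrow> f \<in> C0 \<Longrightarrow> (\<lambda>x. \<integral>y. f y \<partial>P t x) \<in> C0"
  using P by (simp add: feller_semigroup_def)

lemma feller_contraction:
  assumes "t \<ge> 0" "x \<ge> 0" "f \<in> C0" "g \<in> C0" "\<And>y. y \<ge> 0 \<Longrightarrow> \<bar>f y - g y\<bar> \<le> e"
  shows "\<bar>(\<integral>y. f y \<partial>P t x) - (\<integral>y. g y \<partial>P t x)\<bar> \<le> e"
proof -
  interpret prob_space "P t x" by (rule feller_prob) fact+
  note int = feller_integrable[OF assms(1,2)]
  have "\<bar>(\<integral>y. f y \<partial>P t x) - (\<integral>y. g y \<partial>P t x)\<bar> = \<bar>\<integral>y. f y - g y \<partial>P t x\<bar>"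
    using int assms by simp
  also have "\<dots> \<le> (\<integral>y. \<bar>f y - g y\<bar> \<partial>P t x)"
    by (rule integral_abs_bound)
  also have "\<dots> \<le> (\<integral>y. e \<partial>P t x)"
    by (rule integral_mono) (use int assms in \<open>auto simp: feller_prob(3)\<close>)
  finally show ?thesis by (simp add: prob_space)
qed

lemma feller_semigroup_integral:
  assumes "s \<ge> 0" "t \<ge> 0" "x \<ge> 0" "f \<in> C0"
  shows "(\<integral>y. f y \<partial>P (s + t) x) = (\<integral>y. (\<integral>z. f z \<partial>P t y) \<partial>P s x)"
proof -
  obtain B where B: "\<And>x. x \<ge> 0 \<Longrightarrow> \<bar>f x\<bar> \<le> B" using C0_bounded[OF assms(4)] by blast
  have "(\<integral>y. f y \<partial>(P s x \<bind> P t)) = (\<integral>y. (\<integral>z. f z \<partial>P t y) \<partial>P s x)"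
  proof (rule integral_bind[where K=half_line and B=B and B'=1])
    show "P t \<in> P s x \<rightarrow>\<^sub>M subprob_algebra half_line"
      using measurable_prob_algebraD[OF feller_prob_algebra[OF assms(2)]]
        measurable_cong_sets[OF feller_prob(2)[OF assms(1,3)] refl] by blast
    show "finite_measure (P s x)" using feller_prob(1)[OF assms(1,3)] by (simp add: prob_space_def)
    have "emeasure (P t y) (space (P t y)) \<le> ennreal 1" if "y \<in> space (P s x)" for y
    proof -
      have "prob_space (P t y)"
        using that feller_prob(3)[OF assms(1,3)] by (intro feller_prob assms(2)) auto
      then show ?thesis by (simp add: prob_space.emeasure_space_1)
    qed
    then show "AE y in P s x. emeasure (P t y) (space (P t y)) \<le> ennreal 1" by auto
  qed (use assms B feller_prob[OF assms(1,3)] in \<open>auto simp: C0_measurable\<close>)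
  then show ?thesis using P assms by (simp add: feller_semigroup_def)
qed

text \<open>For \<open>u\<close> solving the Cauchy problem, \<open>s \<mapsto> P(t - s) u(s)\<close> has vanishing right derivative.\<close>

lemma feller_cauchy_problem_unique:
  assumes "t \<ge> 0" "x \<ge> 0"
    and gen: "\<And>s. 0 \<le> s \<Longrightarrow> s \<le> t \<Longrightarrow> (u s, g s) \<in> generator P"
    and right: "\<And>s. 0 \<le> s \<Longrightarrow> s < t \<Longrightarrow>
       uniform_limit {0..} (\<lambda>h x. (u (s + h) x - u s x) / h) (g s) (at_right 0)"
    and left: "\<And>s. 0 < s \<Longrightarrow> s \<le> t \<Longrightarrow> uniform_limit {0..} (\<lambda>h. u (s - h)) (u s) (at_right 0)"
  shows "(\<integral>y. u 0 y \<partial>P t x) = u t x"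
proof -
  define F where "F s = (\<integral>y. u s y \<partial>P (t - s) x)" for s
  have C0: "u s \<in> C0" if "0 \<le> s" "s \<le> t" for s using gen[OF that] by (simp add: generator_def)
  have "F t = F 0"
  proof (rule zero_right_derivative_imp_const[where F=F and a=0 and b=t])
    fix s e :: real assume s: "0 \<le> s" "s < t" and e: "e > 0"
    have "\<forall>\<^sub>F h in at_right 0. \<forall>x\<in>{0..}. dist ((u (s + h) x - u s x) / h) (g s x) < e / 2"
      using right[OF s] e by (intro uniform_limitD) auto
    moreover have "\<forall>\<^sub>F h in at_right 0. \<forall>x\<in>{0..}. dist (((\<integral>y. u s y \<partial>P h x) - u s x) / h) (g s x) < e / 2"
      using gen[of s] s e by (intro uniform_limitD) (auto simp: generator_def)
    moreover have "\<forall>\<^sub>F h in at_right 0. 0 < h \<and> h < t - s"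
      using s unfolding eventually_at_right_field by (intro exI[of _ "t - s"]) auto
    ultimately show "\<forall>\<^sub>F h in at_right 0. \<bar>F (s + h) - F s\<bar> \<le> e * h"
    proof eventually_elim
      case (elim h)
      \<comment> \<open>Splitting off the last time step \<open>h\<close> puts \<open>F s\<close>
        and \<open>F (s + h)\<close> under the same kernel. By contraction only the supremum
        distance of \<open>u (s + h)\<close> and P_h \<open>u s\<close> matters, and both difference
        quotients are within \<open>e / 2\<close> of \<open>g s\<close>.\<close>
      have "F s = (\<integral>y. (\<integral>z. u s z \<partial>P h y) \<partial>P (t - (s + h)) x)"
        using feller_semigroup_integral[of "t - (s + h)" h x "u s"] elim s C0[of s] assms(2)
        by (simp add: F_def)
      moreover have "\<bar>(\<integral>y. u (s + h) y \<partial>P (t - (s + h)) x) - (\<integral>y. (\<integral>z. u s z \<partial>P h y) \<partial>P (t - (s + h)) x)\<bar> \<le> e * h"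
      proof (rule feller_contraction)
        fix y :: real assume "y \<ge> 0"
        with elim have "dist ((u (s + h) y - u s y) / h) (g s y) < e / 2"
          "dist (((\<integral>z. u s z \<partial>P h y) - u s y) / h) (g s y) < e / 2" by auto
        then have "\<bar>(u (s + h) y - u s y) / h - ((\<integral>z. u s z \<partial>P h y) - u s y) / h\<bar> < e"
          unfolding dist_real_def by linarith
        then have "\<bar>(u (s + h) y - (\<integral>z. u s z \<partial>P h y)) / h\<bar> < e"
          by (simp add: diff_divide_distrib)
        then show "\<bar>u (s + h) y - (\<integral>z. u s z \<partial>P h y)\<bar> \<le> e * h"
          using elim by (simp add: field_simps)
      qed (use elim s assms(2) C0 feller_integral_C0 in auto)
      ultimately show ?case by (simp add: F_def)
    qed
  next
    fix s :: real assume s: "0 < s" "s \<le> t"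
    show "((\<lambda>h. F (s - h)) \<longlongrightarrow> F s) (at_right 0)"
    proof (rule tendstoI)
      fix e :: real assume e: "e > 0"
      have "\<forall>\<^sub>F h in at_right 0. \<forall>x\<in>{0..}. dist (u (s - h) x) (u s x) < e / 3"
        using left[OF s] e by (intro uniform_limitD) auto
      moreover have "\<forall>\<^sub>F h in at_right 0. \<forall>x\<in>{0..}. dist (\<integral>y. u s y \<partial>P h x) (u s x) < e / 3"
        using P C0[of s] s e by (intro uniform_limitD) (auto simp: feller_semigroup_def)
      moreover have "\<forall>\<^sub>F h in at_right 0. 0 < h \<and> h < s"
        using s by (auto simp: eventually_at_right_field)
      ultimately show "\<forall>\<^sub>F h in at_right 0. dist (F (s - h)) (F s) < e"
      proof eventually_elim
        case (elim h)
        \<comment> \<open>The same splitting to the left: one third of \<open>e\<close> for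
          replacing \<open>u (s - h)\<close> by \<open>u s\<close>, one third for strong continuity
          at 0, and the remaining third makes the inequality strict.\<close>
        have "F (s - h) = (\<integral>y. (\<integral>z. u (s - h) z \<partial>P h y) \<partial>P (t - s) x)"
          using feller_semigroup_integral[of "t - s" h x "u (s - h)"] elim s C0[of "s - h"] assms(2)
          by (simp add: F_def algebra_simps)
        moreover have "\<bar>(\<integral>y. (\<integral>z. u (s - h) z \<partial>P h y) \<partial>P (t - s) x) - (\<integral>y. u s y \<partial>P (t - s) x)\<bar> \<le> e / 3 + e / 3"
        proof (rule feller_contraction)
          fix y :: real assume y: "y \<ge> 0"
          have "\<bar>(\<integral>z. u (s - h) z \<partial>P h y) - (\<integral>z. u s z \<partial>P h y)\<bar> \<le> e / 3"
            by (rule feller_contraction)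
              (use elim s y C0 in \<open>auto simp: dist_real_def less_imp_le\<close>)
          moreover have "\<bar>(\<integral>z. u s z \<partial>P h y) - u s y\<bar> < e / 3"
            using elim y by (simp add: dist_real_def)
          ultimately show "\<bar>(\<integral>z. u (s - h) z \<partial>P h y) - u s y\<bar> \<le> e / 3 + e / 3" by linarith
        qed (use elim s assms(2) C0 feller_integral_C0 in auto)
        ultimately show ?case using e by (simp add: F_def dist_real_def)
      qed
    qed
  qed (use assms in simp)
  moreover have "F t = u t x"
  proof -
    have "P 0 x = return half_line x" using P assms(2) by (simp add: feller_semigroup_def)
    then show ?thesis
      using integral_return[of x half_line "u t"] C0[of t] assms by (simp add: F_def C0_measurable)
  qed
  ultimately show ?thesis by (simp add: F_def)
qed

end

section \<open>Laplace transform of the CIR semigroup\<close>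

lemma mult_exp_neg_le:
  assumes "c > (0::real)"
  shows "x * exp (- c * x) \<le> 1 / c"
proof -
  have "c * x \<le> exp (c * x)" using exp_ge_add_one_self[of "c * x"] by linarith
  then have "c * x * exp (- c * x) \<le> exp (c * x) * exp (- c * x)"
    by (intro mult_right_mono) auto
  then show ?thesis using assms by (simp add: exp_add[symmetric] field_simps)
qed

lemma square_mult_exp_neg_le:
  assumes "c > (0::real)" "x \<ge> 0"
  shows "x\<^sup>2 * exp (- c * x) \<le> 4 / c\<^sup>2"
proof -
  have "(x * exp (- (c / 2) * x))\<^sup>2 \<le> (1 / (c / 2))\<^sup>2"
    using assms by (intro power_mono mult_exp_neg_le) auto
  then show ?thesis
    by (simp add: power_mult_distrib power_divide exp_double[symmetric])
qed

lemma abs_exp_minus_one_le: "\<bar>exp y - 1\<bar> \<le> \<bar>y\<bar> * exp \<bar>y :: real\<bar>"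
proof -
  have "1 - y \<le> exp (- y)" using exp_ge_add_one_self[of "- y"] by simp
  then have "(1 - y) * exp y \<le> exp (- y) * exp y" by (intro mult_right_mono) auto
  then have 1: "exp y - 1 \<le> y * exp y" by (simp add: exp_add[symmetric] algebra_simps)
  show ?thesis
  proof (cases "y \<ge> 0")
    case False
    have "1 - exp y \<le> \<bar>y\<bar> * 1" using exp_ge_add_one_self[of y] False by linarith
    also have "\<dots> \<le> \<bar>y\<bar> * exp \<bar>y\<bar>" by (intro mult_left_mono) auto
    finally show ?thesis using False by (simp add: abs_if)
  qed (use 1 in simp)
qed

lemma abs_exp_minus_one_minus_le: "\<bar>exp y - 1 - y\<bar> \<le> y\<^sup>2 * exp \<bar>y :: real\<bar>"
proof -
  have "1 - y \<le> exp (- y)" using exp_ge_add_one_self[of "- y"] by simp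
  then have "(1 - y) * exp y \<le> exp (- y) * exp y" by (intro mult_right_mono) auto
  then have "exp y - 1 - y \<le> y * (exp y - 1)" by (simp add: exp_add[symmetric] algebra_simps)
  also have "\<dots> \<le> \<bar>y\<bar> * \<bar>exp y - 1\<bar>" by (metis abs_ge_self abs_mult)
  also have "\<dots> \<le> \<bar>y\<bar> * (\<bar>y\<bar> * exp \<bar>y\<bar>)" by (intro mult_left_mono abs_exp_minus_one_le) auto
  also have "\<dots> = y\<^sup>2 * exp \<bar>y\<bar>" by (simp add: power2_eq_square mult.assoc[symmetric])
  finally show ?thesis using exp_ge_add_one_self[of y] by linarith
qed

text \<open>First and second order Taylor estimates in the rate, uniform over the unbounded range of
  \<open>x\<close>. Since |d| \<le> c/2, the factor exp |d x| uses up at most half of the decay; the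
  remaining exp (- (c/2) x) absorbs \<open>x\<close> and its square. The constants 2/c and 16/c^2
  are the earlier bounds at rate c/2.\<close>

lemma exp_rate_perturbation:
  fixes c d x :: real
  assumes c: "c > 0" and d: "\<bar>d\<bar> \<le> c / 2" and x: "x \<ge> 0"
  shows "\<bar>exp (- (c + d) * x) - exp (- c * x)\<bar> \<le> \<bar>d\<bar> * (2 / c)"
    and "\<bar>exp (- (c + d) * x) - exp (- c * x) + d * x * exp (- c * x)\<bar> \<le> d\<^sup>2 * (16 / c\<^sup>2)"
proof -
  have *: "exp (- c * x) * exp \<bar>- d * x\<bar> \<le> exp (- (c / 2) * x)"
  proof -
    have "\<bar>d\<bar> * x \<le> c / 2 * x" using d x by (rule mult_right_mono)
    then show ?thesis using x by (simp add: exp_add[symmetric] abs_mult)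
  qed
  have split: "exp (- (c + d) * x) = exp (- c * x) * exp (- d * x)"
    by (simp add: exp_add[symmetric] algebra_simps)
  have "exp (- (c + d) * x) - exp (- c * x) = exp (- c * x) * (exp (- d * x) - 1)"
    unfolding split by (simp add: right_diff_distrib)
  then have "\<bar>exp (- (c + d) * x) - exp (- c * x)\<bar> = exp (- c * x) * \<bar>exp (- d * x) - 1\<bar>"
    by (simp add: abs_mult)
  also have "\<dots> \<le> exp (- c * x) * (\<bar>- d * x\<bar> * exp \<bar>- d * x\<bar>)"
    by (intro mult_left_mono abs_exp_minus_one_le) auto
  also have "\<dots> = \<bar>- d * x\<bar> * (exp (- c * x) * exp \<bar>- d * x\<bar>)" by (simp only: ac_simps)
  also have "\<dots> \<le> \<bar>- d * x\<bar> * exp (- (c / 2) * x)" by (intro mult_left_mono *) auto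
  also have "\<dots> = \<bar>d\<bar> * (x * exp (- (c / 2) * x))" using x by (simp add: abs_mult)
  also have "\<dots> \<le> \<bar>d\<bar> * (1 / (c / 2))" using c by (intro mult_left_mono mult_exp_neg_le) auto
  finally show "\<bar>exp (- (c + d) * x) - exp (- c * x)\<bar> \<le> \<bar>d\<bar> * (2 / c)" by simp
  have "exp (- (c + d) * x) - exp (- c * x) + d * x * exp (- c * x)
      = exp (- c * x) * (exp (- d * x) - 1 - (- d * x))"
    unfolding split by (simp add: algebra_simps)
  then have "\<bar>exp (- (c + d) * x) - exp (- c * x) + d * x * exp (- c * x)\<bar>
      = exp (- c * x) * \<bar>exp (- d * x) - 1 - (- d * x)\<bar>"
    by (simp add: abs_mult)
  also have "\<dots> \<le> exp (- c * x) * ((- d * x)\<^sup>2 * exp \<bar>- d * x\<bar>)"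
    by (intro mult_left_mono abs_exp_minus_one_minus_le) auto
  also have "\<dots> = (- d * x)\<^sup>2 * (exp (- c * x) * exp \<bar>- d * x\<bar>)" by (simp only: ac_simps)
  also have "\<dots> \<le> (- d * x)\<^sup>2 * exp (- (c / 2) * x)" by (intro mult_left_mono *) auto
  also have "\<dots> = d\<^sup>2 * (x\<^sup>2 * exp (- (c / 2) * x))" by (simp add: power_mult_distrib)
  also have "\<dots> \<le> d\<^sup>2 * (4 / (c / 2)\<^sup>2)"
    using c x by (intro mult_left_mono square_mult_exp_neg_le) auto
  finally show "\<bar>exp (- (c + d) * x) - exp (- c * x) + d * x * exp (- c * x)\<bar> \<le> d\<^sup>2 * (16 / c\<^sup>2)"
    by (simp add: power_divide)
qed

section \<open>Time continuity and time derivative of exponential families in the supremum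
  norm\<close>

lemma uniform_limit_of_bound:
  assumes "(E \<longlongrightarrow> 0) F" "\<forall>\<^sub>F h in F. \<forall>x\<in>S. dist (f h x) (g x) \<le> E h"
  shows "uniform_limit S f g F"
proof (rule uniform_limitI)
  fix e :: real assume "e > 0"
  then have "\<forall>\<^sub>F h in F. E h < e" using assms(1) by (rule order_tendstoD(2)[rotated])
  with assms(2) show "\<forall>\<^sub>F h in F. \<forall>x\<in>S. dist (f h x) (g x) < e"
    by eventually_elim fastforce
qed

lemma uniform_limit_exp_family:
  fixes A \<phi> :: "real \<Rightarrow> real"
  assumes "isCont A s" "isCont \<phi> s" "\<phi> s > 0"
  shows "uniform_limit {0..} (\<lambda>h x. A (s + h) * exp (- \<phi> (s + h) * x)) (\<lambda>x. A s * exp (- \<phi> s * x)) (at 0)"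
proof -
  define c where "c = \<phi> s"
  define d where "d h = \<phi> (s + h) - c" for h
  have c: "c > 0" using assms by (simp add: c_def)
  have A0: "((\<lambda>h. A (s + h)) \<longlongrightarrow> A s) (at 0)" using assms(1) by (simp add: isCont_iff)
  have "((\<lambda>h. \<phi> (s + h)) \<longlongrightarrow> \<phi> s) (at 0)" using assms(2) by (simp add: isCont_iff)
  then have d0: "(d \<longlongrightarrow> 0) (at 0)"
    unfolding d_def c_def using tendsto_diff[OF _ tendsto_const, of _ "\<phi> s" "at 0" "\<phi> s"] by simp
  have phi: "\<phi> (s + h) = c + d h" for h by (simp add: d_def)
  show ?thesis
  proof (rule uniform_limit_of_bound)
    have "((\<lambda>h. \<bar>A (s + h) - A s\<bar> + \<bar>A s\<bar> * (\<bar>d h\<bar> * (2 / c))) \<longlongrightarrow> \<bar>A s - A s\<bar> + \<bar>A s\<bar> * (\<bar>0\<bar> * (2 / c))) (at 0)"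
      by (intro tendsto_intros A0 d0)
    then show "((\<lambda>h. \<bar>A (s + h) - A s\<bar> + \<bar>A s\<bar> * (\<bar>d h\<bar> * (2 / c))) \<longlongrightarrow> 0) (at 0)" by simp
    have "\<forall>\<^sub>F h in at 0. dist (d h) 0 < c / 2" using c by (intro tendstoD[OF d0]) auto
    then show "\<forall>\<^sub>F h in at 0. \<forall>x\<in>{0..}. dist (A (s + h) * exp (- \<phi> (s + h) * x)) (A s * exp (- \<phi> s * x))
        \<le> \<bar>A (s + h) - A s\<bar> + \<bar>A s\<bar> * (\<bar>d h\<bar> * (2 / c))"
    proof eventually_elim
      case (elim h)
      show ?case
      proof
        fix x :: real assume "x \<in> {0..}"
        then have x: "x \<ge> 0" by simp
        have d: "\<bar>d h\<bar> \<le> c / 2" using elim by (simp add: dist_real_def)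
        have le1: "exp (- (c + d h) * x) \<le> 1"
          using x d c by (intro iffD2[OF exp_le_one_iff] mult_nonpos_nonneg) auto
        have "A (s + h) * exp (- (c + d h) * x) - A s * exp (- c * x) =
            (A (s + h) - A s) * exp (- (c + d h) * x) + A s * (exp (- (c + d h) * x) - exp (- c * x))"
          by (simp add: algebra_simps)
        also have "\<bar>\<dots>\<bar> \<le> \<bar>A (s + h) - A s\<bar> * 1 + \<bar>A s\<bar> * (\<bar>d h\<bar> * (2 / c))"
          by (rule order_trans[OF abs_triangle_ineq], unfold abs_mult,
              intro add_mono mult_left_mono exp_rate_perturbation) (use le1 c d x in auto)
        finally show "dist (A (s + h) * exp (- \<phi> (s + h) * x)) (A s * exp (- \<phi> s * x))
            \<le> \<bar>A (s + h) - A s\<bar> + \<bar>A s\<bar> * (\<bar>d h\<bar> * (2 / c))"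
          by (simp add: dist_real_def phi c_def)
      qed
    qed
  qed
qed

text \<open>The product rule with an error bound independent of \<open>x\<close>. Pointwise
  differentiation would not be enough, since the generator is defined with the supremum
  norm.\<close>

lemma uniform_limit_exp_family_derivative:
  fixes A \<phi> :: "real \<Rightarrow> real"
  assumes DA: "(A has_real_derivative A') (at s)" and D\<phi>: "(\<phi> has_real_derivative \<phi>') (at s)" and "\<phi> s > 0"
  shows "uniform_limit {0..} (\<lambda>h x. (A (s + h) * exp (- \<phi> (s + h) * x) - A s * exp (- \<phi> s * x)) / h)
     (\<lambda>x. (A' - A s * \<phi>' * x) * exp (- \<phi> s * x)) (at 0)"
proof -
  define c where "c = \<phi> s"
  define d where "d h = \<phi> (s + h) - c" for h
  define a where "a h = A (s + h) - A s" for h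
  have c: "c > 0" using assms by (simp add: c_def)
  have a': "((\<lambda>h. a h / h) \<longlongrightarrow> A') (at 0)" using DA by (simp add: a_def DERIV_def)
  have d': "((\<lambda>h. d h / h) \<longlongrightarrow> \<phi>') (at 0)" using D\<phi> by (simp add: d_def c_def DERIV_def)
  have "((\<lambda>h. \<phi> (s + h)) \<longlongrightarrow> \<phi> s) (at 0)" using DERIV_isCont[OF D\<phi>] by (simp add: isCont_iff)
  then have d0: "(d \<longlongrightarrow> 0) (at 0)"
    unfolding d_def c_def using tendsto_diff[OF _ tendsto_const, of _ "\<phi> s" "at 0" "\<phi> s"] by simp
  have triangle4: "\<bar>p + q + r - v\<bar> \<le> \<bar>p\<bar> + \<bar>q\<bar> + \<bar>r\<bar> + \<bar>v\<bar>" for p q r v :: real by linarith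
  have phi: "\<phi> (s + h) = c + d h" for h by (simp add: d_def)
  have A: "A (s + h) = A s + a h" for h by (simp add: a_def)
  \<comment> \<open>One summand per source of error: the difference quotient of \<open>A\<close>,
    the change of the exponential next to \<open>A'\<close>, the second order remainder in the
    exponent, and the difference quotient of \<open>\<phi>\<close>.\<close>
  define E where "E h = \<bar>a h / h - A'\<bar> * 1 + \<bar>A'\<bar> * (\<bar>d h\<bar> * (2 / c))
     + \<bar>A s\<bar> * (\<bar>d h / h\<bar> * \<bar>d h\<bar> * (16 / c\<^sup>2)) + \<bar>A s\<bar> * \<bar>d h / h - \<phi>'\<bar> * (1 / c)" for h
  show ?thesis
  proof (rule uniform_limit_of_bound)
    have "(E \<longlongrightarrow> \<bar>A' - A'\<bar> * 1 + \<bar>A'\<bar> * (\<bar>0\<bar> * (2 / c))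
       + \<bar>A s\<bar> * (\<bar>\<phi>'\<bar> * \<bar>0\<bar> * (16 / c\<^sup>2)) + \<bar>A s\<bar> * \<bar>\<phi>' - \<phi>'\<bar> * (1 / c)) (at 0)"
      unfolding E_def by (intro tendsto_intros a' d' d0)
    then show "(E \<longlongrightarrow> 0) (at 0)" by simp
    have "\<forall>\<^sub>F h in at 0. dist (d h) 0 < c / 2" using c by (intro tendstoD[OF d0]) auto
    moreover have "\<forall>\<^sub>F h in at 0. h \<noteq> (0::real)" by (rule eventually_neq_at_within)
    ultimately show "\<forall>\<^sub>F h in at 0. \<forall>x\<in>{0..}.
        dist ((A (s + h) * exp (- \<phi> (s + h) * x) - A s * exp (- \<phi> s * x)) / h)
          ((A' - A s * \<phi>' * x) * exp (- \<phi> s * x)) \<le> E h"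
    proof eventually_elim
      case (elim h)
      show ?case
      proof
        fix x :: real assume "x \<in> {0..}"
        then have x: "x \<ge> 0" by simp
        have d: "\<bar>d h\<bar> \<le> c / 2" using elim by (simp add: dist_real_def)
        have le1: "exp (- (c + d h) * x) \<le> 1"
          using x d c by (intro iffD2[OF exp_le_one_iff] mult_nonpos_nonneg) auto
        define e1 e2 where "e1 = exp (- c * x)" and "e2 = exp (- (c + d h) * x)"
        have "((A s + a h) * e2 - A s * e1) / h - (A' - A s * \<phi>' * x) * e1 =
            (a h / h - A') * e2 + A' * (e2 - e1) + A s * ((e2 - e1 + d h * x * e1) / h)
              - A s * (d h / h - \<phi>') * (x * e1)"
          using elim by (simp add: field_simps)
        also have "\<bar>\<dots>\<bar> \<le> \<bar>a h / h - A'\<bar> * \<bar>e2\<bar> + \<bar>A'\<bar> * \<bar>e2 - e1\<bar>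
            + \<bar>A s\<bar> * \<bar>(e2 - e1 + d h * x * e1) / h\<bar> + \<bar>A s\<bar> * \<bar>d h / h - \<phi>'\<bar> * \<bar>x * e1\<bar>"
          by (rule order_trans[OF triangle4]) (simp add: abs_mult)
        also have "\<dots> \<le> E h"
          unfolding E_def
        proof (intro add_mono mult_left_mono)
          show "\<bar>e2\<bar> \<le> 1" using le1 by (simp add: e2_def)
          show "\<bar>e2 - e1\<bar> \<le> \<bar>d h\<bar> * (2 / c)"
            unfolding e1_def e2_def by (rule exp_rate_perturbation) fact+
          have sq: "(d h)\<^sup>2 = \<bar>d h\<bar> * \<bar>d h\<bar>" by (simp add: power2_eq_square)
          have "\<bar>(e2 - e1 + d h * x * e1) / h\<bar> = \<bar>e2 - e1 + d h * x * e1\<bar> / \<bar>h\<bar>" by (rule abs_divide)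
          also have "\<dots> \<le> (d h)\<^sup>2 * (16 / c\<^sup>2) / \<bar>h\<bar>"
            unfolding e1_def e2_def by (intro divide_right_mono exp_rate_perturbation c d x) auto
          also have "\<dots> = \<bar>d h / h\<bar> * \<bar>d h\<bar> * (16 / c\<^sup>2)"
            unfolding sq abs_divide by simp
          finally show "\<bar>(e2 - e1 + d h * x * e1) / h\<bar> \<le> \<bar>d h / h\<bar> * \<bar>d h\<bar> * (16 / c\<^sup>2)" .
          show "\<bar>x * e1\<bar> \<le> 1 / c" using mult_exp_neg_le[OF c, of x] x by (simp add: e1_def abs_mult)
        qed auto
        finally show "dist ((A (s + h) * exp (- \<phi> (s + h) * x) - A s * exp (- \<phi> s * x)) / h)
          ((A' - A s * \<phi>' * x) * exp (- \<phi> s * x)) \<le> E h"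
          unfolding dist_real_def phi A e1_def e2_def c_def .
      qed
    qed
  qed
qed

lemma tendsto_affine_mult_exp_neg:
  assumes "c > (0::real)"
  shows "((\<lambda>x. (a + b * x) * exp (- c * x)) \<longlongrightarrow> 0) at_top"
proof -
  have lim: "filterlim (\<lambda>x. c * x) at_top at_top"
    using assms by (intro filterlim_tendsto_pos_mult_at_top[OF tendsto_const _ filterlim_ident]) auto
  have "((\<lambda>x. (c * x) ^ k / exp (c * x)) \<longlongrightarrow> 0) at_top" for k
    using filterlim_compose[OF tendsto_power_div_exp_0 lim] .
  from this[of 0] this[of 1]
  have "((\<lambda>x. a * (1 / exp (c * x)) + b / c * (c * x / exp (c * x))) \<longlongrightarrow> a * 0 + b / c * 0) at_top"
    by (intro tendsto_intros) auto
  then show ?thesis using assms by (simp add: exp_minus field_simps)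
qed

lemma affine_mult_exp_neg_C0: "c > 0 \<Longrightarrow> (\<lambda>x. (a + b * x) * exp (- c * x)) \<in> C0"
  using tendsto_affine_mult_exp_neg[of c a b] by (auto simp: C0_def intro!: continuous_intros)

text \<open>An exponential goes to an affine function times the same exponential, which is also the
  shape of the time derivative (A' - A \<phi>' x) exp (- \<phi> x). Comparing coefficients gives A'
  = - \<alpha> A \<phi> / 2 and \<phi>' = - (\<beta> \<phi> + \<phi>^2) / 2, the equations to be
  solved.\<close>

lemma exp_in_cir_operator:
  assumes "c > 0"
  shows "(\<lambda>x. a * exp (- c * x), \<lambda>x. (- (\<alpha> * a * c / 2) + a * (\<beta> * c / 2 + c\<^sup>2 / 2) * x) * exp (- c * x))
    \<in> cir_operator \<alpha> \<beta>"
  unfolding cir_operator_def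
proof (intro CollectI case_prodI conjI)
  show "(\<lambda>x. a * exp (- c * x)) \<in> C0" using affine_mult_exp_neg_C0[OF assms, of a 0] by simp
  show "(\<lambda>x. (- (\<alpha> * a * c / 2) + a * (\<beta> * c / 2 + c\<^sup>2 / 2) * x) * exp (- c * x)) \<in> C0"
    by (rule affine_mult_exp_neg_C0) fact
  show "\<exists>f' f''. (\<forall>x\<ge>0. ((\<lambda>x. a * exp (- c * x)) has_real_derivative f' x) (at x within {0..})) \<and>
    (\<forall>x\<ge>0. (f' has_real_derivative f'' x) (at x within {0..})) \<and> continuous_on {0..} f'' \<and>
    (\<forall>x\<ge>0. (- (\<alpha> * a * c / 2) + a * (\<beta> * c / 2 + c\<^sup>2 / 2) * x) * exp (- c * x)
       = 1/2 * (\<alpha> - \<beta> * x) * f' x + 1/2 * x * f'' x)"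
    by (rule exI[of _ "\<lambda>x. - c * a * exp (- c * x)"], rule exI[of _ "\<lambda>x. c\<^sup>2 * a * exp (- c * x)"])
      (auto intro!: derivative_eq_intros continuous_intros simp: power2_eq_square field_simps)
qed

text \<open>Its logarithmic derivative in \<open>t\<close> is half of \<open>cir_rate\<close>, so
  its power with exponent - \<alpha> solves the equation for the prefactor, with value 1 at time
  0.\<close>

definition cir_den :: "real \<Rightarrow> real \<Rightarrow> real \<Rightarrow> real" where
  "cir_den \<beta> c t = 1 + c / \<beta> * (1 - exp (- \<beta> * t / 2))"

text \<open>The solution of the Riccati equation with value \<open>c\<close> at time 0. It is found
  by passing to w = 1/\<phi>, which satisfies the linear equation w' = (\<beta> w + 1) / 2.\<close>

definition cir_rate :: "real \<Rightarrow> real \<Rightarrow> real \<Rightarrow> real" where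
  "cir_rate \<beta> c t = c * exp (- \<beta> * t / 2) / cir_den \<beta> c t"

lemma cir_den_ge_1:
  assumes "\<beta> > 0" "c > 0" "t \<ge> 0"
  shows "cir_den \<beta> c t \<ge> 1"
proof -
  have "exp (- \<beta> * t / 2) \<le> 1" using assms by simp
  then show ?thesis using assms by (simp add: cir_den_def)
qed

lemma cir_rate_pos: "\<beta> > 0 \<Longrightarrow> c > 0 \<Longrightarrow> t \<ge> 0 \<Longrightarrow> cir_rate \<beta> c t > 0"
  using cir_den_ge_1[of \<beta> c t] by (simp add: cir_rate_def)

lemma cir_den_deriv:
  "\<beta> > 0 \<Longrightarrow> (cir_den \<beta> c has_real_derivative c * exp (- \<beta> * t / 2) / 2) (at t)"
  unfolding cir_den_def[abs_def] by (auto intro!: derivative_eq_intros simp: field_simps)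

text \<open>The Riccati equation satisfied by the exponent of the Laplace transform.\<close>

lemma cir_rate_deriv:
  assumes "\<beta> > 0" "c > 0" "t \<ge> 0"
  shows "(cir_rate \<beta> c has_real_derivative - (\<beta> * cir_rate \<beta> c t / 2 + (cir_rate \<beta> c t)\<^sup>2 / 2)) (at t)"
proof -
  have D: "cir_den \<beta> c t > 0" using cir_den_ge_1[OF assms] by simp
  have N: "((\<lambda>t. c * exp (- \<beta> * t / 2)) has_real_derivative - (\<beta> * c * exp (- \<beta> * t / 2) / 2)) (at t)"
    by (auto intro!: derivative_eq_intros)
  show ?thesis unfolding cir_rate_def[abs_def]
    by (rule DERIV_divide[OF N cir_den_deriv, THEN DERIV_cong])
      (use assms D in \<open>simp_all add: field_simps power2_eq_square\<close>)
qed

lemma cir_den_powr_deriv: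
  assumes "\<beta> > 0" "c > 0" "t \<ge> 0"
  shows "((\<lambda>t. cir_den \<beta> c t powr (- \<alpha>)) has_real_derivative
     - (\<alpha> * cir_den \<beta> c t powr (- \<alpha>) * cir_rate \<beta> c t / 2)) (at t)"
proof -
  have D: "cir_den \<beta> c t > 0" using cir_den_ge_1[OF assms] by simp
  show ?thesis
    by (rule has_real_derivative_powr'[OF cir_den_deriv[OF assms(1)] DERIV_const D, THEN DERIV_cong])
      (use D in \<open>simp add: cir_rate_def field_simps\<close>)
qed

lemma cir_laplace:
  assumes P: "cir_semigroup \<alpha> \<beta> P" and "\<beta> > 0" "c > 0" "t \<ge> 0" "x \<ge> 0"
  shows "(\<integral>y. exp (- c * y) \<partial>P t x) = cir_den \<beta> c t powr (- \<alpha>) * exp (- cir_rate \<beta> c t * x)"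
proof -
  define A where "A s = cir_den \<beta> c s powr (- \<alpha>)" for s
  define \<phi> where "\<phi> = cir_rate \<beta> c"
  define u where "u s x = A s * exp (- \<phi> s * x)" for s x
  define g where "g s x = (- (\<alpha> * A s * \<phi> s / 2) + A s * (\<beta> * \<phi> s / 2 + (\<phi> s)\<^sup>2 / 2) * x) * exp (- \<phi> s * x)" for s x
  have pos: "\<phi> s > 0" if "s \<ge> 0" for s using cir_rate_pos assms that by (simp add: \<phi>_def)
  have DA: "(A has_real_derivative - (\<alpha> * A s * \<phi> s / 2)) (at s)" if "s \<ge> 0" for s
    using cir_den_powr_deriv[OF assms(2,3) that, of \<alpha>] by (simp add: A_def[abs_def] \<phi>_def)
  have D\<phi>: "(\<phi> has_real_derivative - (\<beta> * \<phi> s / 2 + (\<phi> s)\<^sup>2 / 2)) (at s)" if "s \<ge> 0" for s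
    using cir_rate_deriv[OF assms(2,3) that] by (simp add: \<phi>_def)
  have feller: "feller_semigroup P" using P by (simp add: cir_semigroup_def)
  have "(\<integral>y. u 0 y \<partial>P t x) = u t x"
  proof (rule feller_cauchy_problem_unique[OF feller, where g=g])
    fix s :: real assume "0 \<le> s" "s \<le> t"
    then have "(u s, g s) \<in> cir_operator \<alpha> \<beta>"
      unfolding u_def[abs_def] g_def[abs_def] by (intro exp_in_cir_operator pos)
    then show "(u s, g s) \<in> generator P" using P by (auto simp: cir_semigroup_def)
  next
    fix s :: real assume s: "0 \<le> s" "s < t"
    \<comment> \<open>The derivatives of \<open>A\<close> and \<open>\<phi>\<close> are inserted
      from their differential equations, and the limit rearranges to \<open>g s\<close>, the
      operator applied to \<open>u s\<close>. The limit is two-sided even at \<open>s = 0\<close>,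
      because the formulas make sense for negative times near 0.\<close>
    have "uniform_limit {0..} (\<lambda>h x. (u (s + h) x - u s x) / h)
       (\<lambda>x. (- (\<alpha> * A s * \<phi> s / 2) - A s * - (\<beta> * \<phi> s / 2 + (\<phi> s)\<^sup>2 / 2) * x) * exp (- \<phi> s * x)) (at 0)"
      unfolding u_def using s by (intro uniform_limit_exp_family_derivative DA D\<phi> pos)
    also have "(\<lambda>x. (- (\<alpha> * A s * \<phi> s / 2) - A s * - (\<beta> * \<phi> s / 2 + (\<phi> s)\<^sup>2 / 2) * x) * exp (- \<phi> s * x)) = g s"
      by (auto simp: g_def algebra_simps)
    finally show "uniform_limit {0..} (\<lambda>h x. (u (s + h) x - u s x) / h) (g s) (at_right 0)"
      by (rule filterlim_mono[OF _ order_refl at_le]) simp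
  next
    fix s :: real assume s: "0 < s" "s \<le> t"
    have "uniform_limit {0..} (\<lambda>h x. u (s + h) x) (u s) (at 0)"
      unfolding u_def using s DERIV_isCont[OF DA] DERIV_isCont[OF D\<phi>]
      by (intro uniform_limit_exp_family pos) auto
    then have "uniform_limit {0..} (\<lambda>h x. u (s + h) x) (u s) (at_left 0)"
      by (rule filterlim_mono[OF _ order_refl at_le]) simp
    then show "uniform_limit {0..} (\<lambda>h. u (s - h)) (u s) (at_right 0)"
      by (simp add: filterlim_at_left_to_right[of _ _ 0])
  qed (use assms in auto)
  moreover have "u 0 = (\<lambda>y. exp (- c * y))"
    using assms by (simp add: u_def A_def \<phi>_def cir_rate_def cir_den_def fun_eq_iff)
  ultimately show ?thesis by (simp add: u_def A_def \<phi>_def)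
qed

section \<open>Gamma and Dirichlet distributions\<close>

lemma sets_half_line_borel: "A \<in> sets half_line \<Longrightarrow> A \<in> sets borel"
  by (auto simp: half_line_def sets_restrict_space)

lemma sets_gamma_dist [simp, measurable_cong]: "sets (gamma_dist a b) = sets half_line"
  by (simp add: gamma_dist_def half_line_def sets_restrict_space)

lemma space_gamma_dist [simp]: "space (gamma_dist a b) = {0..}"
  using sets_eq_imp_space_eq[OF sets_gamma_dist] by simp

section \<open>Gamma integrals over the whole line\<close>

text \<open>Extended by zero, the power becomes a function on the whole line, where scaling and
  translation of \<open>lborel\<close> apply directly. Products of such weights also vanish outside
  the region of integration, so the later multiple integrals carry no indicators.\<close>

definition gamma_weight :: "real \<Rightarrow> real \<Rightarrow> real" where
  "gamma_weight a x = (if x > 0 then x powr (a - 1) else 0)"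

lemma gamma_weight_nonneg [simp]: "gamma_weight a x \<ge> 0"
  by (simp add: gamma_weight_def)

lemma gamma_weight_measurable [measurable]: "gamma_weight a \<in> borel_measurable borel"
  unfolding gamma_weight_def[abs_def] by measurable

lemma nn_integral_gamma_weight:
  assumes "a > 0" "b > 0"
  shows "(\<integral>\<^sup>+x. ennreal (gamma_weight a x * exp (- b * x)) \<partial>lborel) = ennreal (Gamma a / b powr a)"
proof -
  let ?I = "\<integral>\<^sup>+x. ennreal (gamma_weight a x * exp (- b * x)) \<partial>lborel"
  have "ennreal (Gamma a) = (\<integral>\<^sup>+x. ennreal (gamma_weight a x * exp (- x)) \<partial>lborel)"
    unfolding Gamma_conv_nn_integral_real[OF assms(1)]
    by (intro nn_integral_cong) (auto simp: gamma_weight_def indicator_def exp_minus divide_inverse)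
  also have "\<dots> = ennreal \<bar>b\<bar> * (\<integral>\<^sup>+x. ennreal (gamma_weight a (0 + b * x) * exp (- (0 + b * x))) \<partial>lborel)"
    by (rule nn_integral_real_affine) (use assms in auto)
  also have "(\<integral>\<^sup>+x. ennreal (gamma_weight a (0 + b * x) * exp (- (0 + b * x))) \<partial>lborel)
      = (\<integral>\<^sup>+x. ennreal (b powr (a - 1)) * ennreal (gamma_weight a x * exp (- b * x)) \<partial>lborel)"
    using assms by (intro nn_integral_cong)
      (auto simp: gamma_weight_def powr_mult zero_less_mult_iff mult.assoc ennreal_mult[symmetric])
  also have "\<dots> = ennreal (b powr (a - 1)) * ?I"
    by (rule nn_integral_cmult) simp
  finally have "ennreal (Gamma a) = ennreal (b * b powr (a - 1)) * ?I"
    using assms by (simp add: ennreal_mult mult.assoc)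
  also have "b * b powr (a - 1) = b powr a" using assms by (simp add: powr_diff)
  finally have eq: "ennreal (Gamma a) = ennreal (b powr a) * ?I" .
  have "ennreal (Gamma a / b powr a) = ennreal (1 / b powr a) * (ennreal (b powr a) * ?I)"
    unfolding eq[symmetric] using assms Gamma_real_pos[OF assms(1)] by (simp add: ennreal_mult[symmetric])
  also have "\<dots> = ?I"
    using assms by (simp add: mult.assoc[symmetric] ennreal_mult[symmetric])
  finally show ?thesis by simp
qed

lemma nn_integral_gamma_dist:
  assumes "f \<in> borel_measurable borel"
  shows "(\<integral>\<^sup>+x. f x \<partial>gamma_dist a b)
    = (\<integral>\<^sup>+x. ennreal (b powr a / Gamma a * (gamma_weight a x * exp (- b * x))) * f x \<partial>lborel)"
proof -
  have f: "f \<in> borel_measurable (restrict_space lborel {0..})"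
    using assms by (intro measurable_restrict_space1) simp
  have d: "(\<lambda>x. ennreal (b powr a / Gamma a * x powr (a - 1) * exp (- b * x)))
      \<in> borel_measurable (restrict_space lborel {0..})"
    by (intro measurable_restrict_space1) simp
  have "(\<integral>\<^sup>+x. f x \<partial>gamma_dist a b)
    = (\<integral>\<^sup>+x. ennreal (b powr a / Gamma a * x powr (a - 1) * exp (- b * x)) * f x \<partial>restrict_space lborel {0..})"
    unfolding gamma_dist_def by (rule nn_integral_density[OF d f])
  also have "\<dots> = (\<integral>\<^sup>+x. ennreal (b powr a / Gamma a * x powr (a - 1) * exp (- b * x)) * f x * indicator {0..} x \<partial>lborel)"
    by (rule nn_integral_restrict_space) simp
  \<comment> \<open>The integrands agree at \<open>x = 0\<close> as well, since
    \<open>0 powr (a - 1)\<close> is 0 by convention.\<close>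
  also have "\<dots> = (\<integral>\<^sup>+x. ennreal (b powr a / Gamma a * (gamma_weight a x * exp (- b * x))) * f x \<partial>lborel)"
    by (intro nn_integral_cong) (auto simp: gamma_weight_def indicator_def mult.assoc)
  finally show ?thesis .
qed

text \<open>Weighting by the exponential only shifts the rate to \<open>b + c\<close>, so the value
  is a quotient of two normalizing constants. The admissible range includes \<open>c = 0\<close>,
  which gives total mass 1.\<close>

lemma gamma_dist_laplace:
  assumes "a > 0" "b > 0" "c > - b"
  shows "(\<integral>\<^sup>+x. ennreal (exp (- c * x)) \<partial>gamma_dist a b) = ennreal ((b / (b + c)) powr a)"
proof -
  have "(\<integral>\<^sup>+x. ennreal (exp (- c * x)) \<partial>gamma_dist a b)
    = (\<integral>\<^sup>+x. ennreal (b powr a / Gamma a) * ennreal (gamma_weight a x * exp (- (b + c) * x)) \<partial>lborel)"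
    using Gamma_real_pos[OF assms(1)]
    by (subst nn_integral_gamma_dist) (auto intro!: nn_integral_cong simp: ennreal_mult[symmetric] mult_exp_exp algebra_simps)
  also have "\<dots> = ennreal (b powr a / Gamma a) * ennreal (Gamma a / (b + c) powr a)"
    using assms nn_integral_gamma_weight[of a "b + c"] by (subst nn_integral_cmult) auto
  also have "\<dots> = ennreal ((b / (b + c)) powr a)"
    using assms Gamma_real_pos[OF assms(1)] Gamma_real_pos[OF assms(1), THEN order_less_imp_not_eq2] by (simp add: ennreal_mult[symmetric] powr_divide)
  finally show ?thesis .
qed

lemma prob_space_gamma_dist:
  assumes "a > 0" "b > 0"
  shows "prob_space (gamma_dist a b)"
  using gamma_dist_laplace[OF assms, of 0] assms by (intro prob_spaceI) simp

lemma emeasure_lborel_vimage_mult: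
  assumes "A \<in> sets borel" "r > (0::real)"
  shows "ennreal r * emeasure lborel ((*) r -` A) = emeasure lborel A"
proof -
  have "emeasure lborel A = (\<integral>\<^sup>+x. indicator A x \<partial>lborel)" using assms by simp
  also have "\<dots> = ennreal \<bar>r\<bar> * (\<integral>\<^sup>+x. indicator A (0 + r * x) \<partial>lborel)"
    by (rule nn_integral_real_affine) (use assms in auto)
  also have "(\<integral>\<^sup>+x. indicator A (0 + r * x) \<partial>lborel) = (\<integral>\<^sup>+x. indicator ((*) r -` A) x \<partial>lborel)"
    by (intro nn_integral_cong) (auto simp: indicator_def)
  also have "\<dots> = emeasure lborel ((*) r -` A)"
    using measurable_sets[of "(*) r" borel borel A] assms by (intro nn_integral_indicator) simp
  finally show ?thesis using assms by simp
qed

text \<open>The scaled image measure is compared with Lebesgue measure on boxes, where the Jacobian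
  splits into one factor \<open>r\<close> per coordinate.\<close>

lemma nn_integral_PiM_lborel_scale:
  fixes F :: "('i \<Rightarrow> real) \<Rightarrow> ennreal"
  assumes I: "finite I" and r: "r > 0" and F [measurable]: "F \<in> borel_measurable (\<Pi>\<^sub>M j\<in>I. lborel)"
  shows "ennreal (r ^ card I) * (\<integral>\<^sup>+y. F (\<lambda>j\<in>I. r * y j) \<partial>(\<Pi>\<^sub>M j\<in>I. lborel)) = (\<integral>\<^sup>+y. F y \<partial>(\<Pi>\<^sub>M j\<in>I. lborel))"
proof -
  let ?P = "\<Pi>\<^sub>M j\<in>I. (lborel :: real measure)" and ?s = "\<lambda>y. \<lambda>j\<in>I. r * y j"
  interpret product_sigma_finite "\<lambda>_::'i. lborel :: real measure" by standard
  have s [measurable]: "?s \<in> ?P \<rightarrow>\<^sub>M ?P" by measurable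
  have "scale_measure (ennreal (r ^ card I)) (distr ?P ?P ?s) = ?P"
  proof (rule PiM_eqI)
    fix A :: "'i \<Rightarrow> real set" assume A: "\<And>i. i \<in> I \<Longrightarrow> A i \<in> sets lborel"
    have vim: "?s -` Pi\<^sub>E I A \<inter> space ?P = (\<Pi>\<^sub>E i\<in>I. (*) r -` A i)"
      by (auto simp: space_PiM PiE_iff)
    have "emeasure (scale_measure (ennreal (r ^ card I)) (distr ?P ?P ?s)) (Pi\<^sub>E I A)
        = ennreal (r ^ card I) * emeasure ?P (\<Pi>\<^sub>E i\<in>I. (*) r -` A i)"
      using A I by (simp add: emeasure_distr vim[symmetric] sets_PiM_I_finite)
    also have "emeasure ?P (\<Pi>\<^sub>E i\<in>I. (*) r -` A i) = (\<Prod>i\<in>I. emeasure lborel ((*) r -` A i))"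
      using measurable_sets[of "(*) r" borel borel] A I by (intro emeasure_PiM) auto
    also have "ennreal (r ^ card I) * \<dots> = (\<Prod>i\<in>I. ennreal r * emeasure lborel ((*) r -` A i))"
      using r by (simp add: prod.distrib ennreal_power)
    also have "\<dots> = (\<Prod>i\<in>I. emeasure lborel (A i))"
      using A r by (intro prod.cong refl emeasure_lborel_vimage_mult) auto
    finally show "emeasure (scale_measure (ennreal (r ^ card I)) (distr ?P ?P ?s)) (Pi\<^sub>E I A) = (\<Prod>i\<in>I. emeasure lborel (A i))" .
  qed (use I in simp_all)
  then have "(\<integral>\<^sup>+y. F y \<partial>?P) = (\<integral>\<^sup>+y. F y \<partial>scale_measure (ennreal (r ^ card I)) (distr ?P ?P ?s))" by simp
  also have "\<dots> = ennreal (r ^ card I) * (\<integral>\<^sup>+y. F y \<partial>distr ?P ?P ?s)"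
    by (rule nn_integral_scale_measure) simp
  also have "(\<integral>\<^sup>+y. F y \<partial>distr ?P ?P ?s) = (\<integral>\<^sup>+y. F (?s y) \<partial>?P)"
    by (rule nn_integral_distr) simp_all
  finally show ?thesis by simp
qed

lemma space_orthant: "space (orthant K) = (\<Pi>\<^sub>E j\<in>{1..K}. {0..})"
  by (simp add: orthant_def space_PiM)

lemma orthant_component_measurable: "j \<in> {1..K} \<Longrightarrow> (\<lambda>x. x j) \<in> borel_measurable (orthant K)"
  unfolding orthant_def
  by (rule measurable_compose[of "\<lambda>x. x j" _ half_line "\<lambda>x. x"])
    (auto intro: measurable_component_singleton measurable_half_line_borel)

lemma sets_dirichlet [simp, measurable_cong]: "sets (dirichlet K a) = sets (orthant K)"
  by (simp add: dirichlet_def)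

lemma space_dirichlet [simp]: "space (dirichlet K a) = space (orthant K)"
  by (simp add: dirichlet_def)

lemma nn_integral_dirichlet:
  assumes K: "K \<ge> 1" and g: "g \<in> borel_measurable (orthant K)"
  shows "(\<integral>\<^sup>+x. g x \<partial>dirichlet K a) = (\<integral>\<^sup>+y. ennreal (Gamma (\<Sum>j\<in>{1..K}. a j) / (\<Prod>j\<in>{1..K}. Gamma (a j))
       * (\<Prod>j\<in>{1..K}. simplex_point K y j powr (a j - 1))) * g (simplex_point K y)
       * indicator (open_simplex K) y \<partial>(\<Pi>\<^sub>M j\<in>{1..<K}. lborel))"
proof -
  let ?P = "\<Pi>\<^sub>M j\<in>{1..<K}. (lborel :: real measure)"
  let ?R = "restrict_space ?P (open_simplex K)"
  have meas: "(\<lambda>y. simplex_point K y j) \<in> borel_measurable ?P" for j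
    unfolding simplex_point_def restrict_def by (cases "j \<in> {1..K}"; cases "j = K") auto
  have sp [measurable]: "simplex_point K \<in> ?R \<rightarrow>\<^sub>M orthant K"
    unfolding orthant_def
  proof (rule measurable_PiM_single')
    fix j assume j: "j \<in> {1..K}"
    show "(\<lambda>y. simplex_point K y j) \<in> ?R \<rightarrow>\<^sub>M half_line"
    proof (rule measurable_half_lineI)
      fix y assume "y \<in> space ?R"
      then show "simplex_point K y j \<ge> 0"
        using j by (auto simp: space_restrict_space open_simplex_def simplex_point_def less_imp_le)
    qed (intro measurable_restrict_space1 meas)
  next
    show "simplex_point K \<in> space ?R \<rightarrow> (\<Pi>\<^sub>E i\<in>{1..K}. space half_line)"
      by (auto simp: space_restrict_space open_simplex_def simplex_point_def less_imp_le PiE_iff)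
  qed
  let ?d = "\<lambda>y. ennreal (Gamma (\<Sum>j\<in>{1..K}. a j) / (\<Prod>j\<in>{1..K}. Gamma (a j))
       * (\<Prod>j\<in>{1..K}. simplex_point K y j powr (a j - 1)))"
  have "(\<lambda>y. \<Prod>j\<in>{1..K}. simplex_point K y j powr (a j - 1)) \<in> borel_measurable ?R"
    by (intro measurable_restrict_space1 borel_measurable_prod powr_real_measurable meas) auto
  then have d: "?d \<in> borel_measurable ?R" by measurable
  have os: "open_simplex K \<inter> space ?P \<in> sets ?P"
  proof -
    have "{x \<in> space ?P. (\<forall>j\<in>{1..<K}. 0 < x j) \<and> (\<Sum>j\<in>{1..<K}. x j) < 1} \<in> sets ?P"
      by measurable
    also have "{x \<in> space ?P. (\<forall>j\<in>{1..<K}. 0 < x j) \<and> (\<Sum>j\<in>{1..<K}. x j) < 1} = open_simplex K \<inter> space ?P"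
      by (auto simp: open_simplex_def)
    finally show ?thesis .
  qed
  have "(\<integral>\<^sup>+x. g x \<partial>dirichlet K a) = (\<integral>\<^sup>+y. g (simplex_point K y) \<partial>density ?R ?d)"
    unfolding dirichlet_def by (rule nn_integral_distr) (use sp g in auto)
  also have "\<dots> = (\<integral>\<^sup>+y. ?d y * g (simplex_point K y) \<partial>?R)"
    by (rule nn_integral_density[OF d measurable_compose[OF sp g]])
  also have "\<dots> = (\<integral>\<^sup>+y. ?d y * g (simplex_point K y) * indicator (open_simplex K) y \<partial>?P)"
    by (rule nn_integral_restrict_space[OF os])
  finally show ?thesis .
qed

text \<open>The substitution \<open>z = r x\<close> is carried out for fixed \<open>r\<close> in the first \<open>K - 1\<close> coordinates;
  after exchanging the integrals, \<open>r\<close> is replaced by the last coordinate \<open>r - z\<^sub>1 - \<dots> - z\<^sub>K\<^sub>-\<^sub>1\<close>.\<close>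

lemma nn_integral_gamma_dirichlet:
  assumes K: "K \<ge> 1" and a: "\<And>j. j \<in> {1..K} \<Longrightarrow> a j > 0" and b: "b > 0"
    and f: "\<And>j. j \<in> {1..K} \<Longrightarrow> f j \<in> borel_measurable borel"
  shows "(\<integral>\<^sup>+r. \<integral>\<^sup>+x. (\<Prod>j\<in>{1..K}. f j (r * x j)) \<partial>dirichlet K a \<partial>gamma_dist (\<Sum>j\<in>{1..K}. a j) b)
     = (\<Prod>j\<in>{1..K}. \<integral>\<^sup>+x. f j x \<partial>gamma_dist (a j) b)"
proof -
  define I where "I = {1..<K}"
  have I: "finite I" "K \<notin> I" "{1..K} = insert K I" "card I = K - 1"
    using K by (auto simp: I_def)
  define A where "A = (\<Sum>j\<in>{1..K}. a j)"
  have A: "A > 0" unfolding A_def using K a by (intro sum_pos) auto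
  have \<Gamma>: "Gamma (a j) > 0" if "j \<in> {1..K}" for j using a[OF that] by (rule Gamma_real_pos)
  have \<Gamma>P: "(\<Prod>j\<in>{1..K}. Gamma (a j)) > 0" using \<Gamma> by (intro prod_pos) auto
  \<comment> \<open>The constant of the joint density: \<open>Gamma A\<close> cancels between the
    normalization of the radial law and that of the Dirichlet law.\<close>
  define C where "C = b powr A / (\<Prod>j\<in>{1..K}. Gamma (a j))"
  have C: "C \<ge> 0" unfolding C_def using \<Gamma>P by simp
  have em: "ennreal p * (ennreal q * x) = ennreal (p * q) * x" if "p \<ge> 0" "q \<ge> 0" for p q x
    using that by (simp add: ennreal_mult mult.assoc)
  let ?P = "\<Pi>\<^sub>M j\<in>I. (lborel :: real measure)"
  interpret product_sigma_finite "\<lambda>_::nat. lborel :: real measure" by standard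
  interpret P: sigma_finite_measure ?P by (rule sigma_finite) (rule I)
  interpret PS: pair_sigma_finite "lborel :: real measure" ?P ..
  have [measurable]: "f j \<in> borel_measurable borel" if "j \<in> I" for j using f[of j] that by (auto simp: I_def)
  have [measurable]: "f K \<in> borel_measurable borel" using f[of K] K by auto
  \<comment> \<open>Integrand in the variables r and z_1, ..., z_(K-1), with last coordinate r - z_1
    - ... - z_(K-1). The weights vanish as soon as one of the K coordinates is not positive.\<close>
  define G where "G r z = ennreal (C * exp (- b * r) * (\<Prod>j\<in>I. gamma_weight (a j) (z j)) * gamma_weight (a K) (r - (\<Sum>j\<in>I. z j)))
     * ((\<Prod>j\<in>I. f j (z j)) * f K (r - (\<Sum>j\<in>I. z j)))" for r z
  have G [measurable]: "case_prod G \<in> borel_measurable (lborel \<Otimes>\<^sub>M ?P)"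
    unfolding G_def by measurable
  define H where "H r y = ennreal (Gamma A / (\<Prod>j\<in>{1..K}. Gamma (a j))
       * (\<Prod>j\<in>{1..K}. simplex_point K y j powr (a j - 1))) * (\<Prod>j\<in>{1..K}. f j (r * simplex_point K y j))
       * indicator (open_simplex K) y" for r y
  have sm: "(\<lambda>y. simplex_point K y j) \<in> borel_measurable ?P" for j
    unfolding simplex_point_def restrict_def I_def by (cases "j \<in> {1..K}"; cases "j = K") auto
  have H: "case_prod H \<in> borel_measurable (lborel \<Otimes>\<^sub>M ?P)"
  proof -
    have "{x \<in> space ?P. (\<forall>j\<in>I. 0 < x j) \<and> (\<Sum>j\<in>I. x j) < 1} \<in> sets ?P"
      using I(1) by measurable
    then have "(indicator {x \<in> space ?P. (\<forall>j\<in>I. 0 < x j) \<and> (\<Sum>j\<in>I. x j) < 1} :: _ \<Rightarrow> ennreal) \<in> borel_measurable ?P"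
      by simp
    then have im: "(indicator (open_simplex K) :: _ \<Rightarrow> ennreal) \<in> borel_measurable ?P"
      by (rule measurable_cong[THEN iffD1, rotated]) (auto simp: open_simplex_def indicator_def I_def)
    have pm: "(\<lambda>y. \<Prod>j\<in>{1..K}. simplex_point K y j powr (a j - 1)) \<in> borel_measurable ?P"
      by (intro borel_measurable_prod powr_real_measurable sm) auto
    have rm: "(\<lambda>p. fst p * simplex_point K (snd p) j) \<in> borel_measurable (lborel \<Otimes>\<^sub>M ?P)" for j
      by (intro borel_measurable_times measurable_compose[OF measurable_snd sm]) auto
    have fm: "(\<lambda>p. \<Prod>j\<in>{1..K}. f j (fst p * simplex_point K (snd p) j)) \<in> borel_measurable (lborel \<Otimes>\<^sub>M ?P)"
      by (intro borel_measurable_prod_ennreal measurable_compose[OF rm f])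
    show ?thesis
      using measurable_compose[OF measurable_snd im] measurable_compose[OF measurable_snd pm] fm
      unfolding H_def case_prod_beta by measurable
  qed
  have D: "(\<integral>\<^sup>+x. (\<Prod>j\<in>{1..K}. f j (r * x j)) \<partial>dirichlet K a) = (\<integral>\<^sup>+y. H r y \<partial>?P)" for r
  proof -
    have "(\<lambda>x. \<Prod>j\<in>{1..K}. f j (r * x j)) \<in> borel_measurable (orthant K)"
      by (intro borel_measurable_prod_ennreal measurable_compose[OF _ f] borel_measurable_times
          borel_measurable_const orthant_component_measurable) auto
    from nn_integral_dirichlet[OF K this] show ?thesis unfolding H_def A_def I_def .
  qed
  have inner: "ennreal (b powr A / Gamma A * (gamma_weight A r * exp (- b * r)))
      * (\<integral>\<^sup>+x. (\<Prod>j\<in>{1..K}. f j (r * x j)) \<partial>dirichlet K a) = (\<integral>\<^sup>+z. G r z \<partial>?P)" for r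
  proof (cases "r > 0")
    case False
    \<comment> \<open>If \<open>r\<close> is not positive, some coordinate is not positive: either
      one of the \<open>z j\<close>, or the last one, \<open>r\<close> minus their sum.\<close>
    have "G r z = 0" for z
    proof (cases "\<forall>j\<in>I. z j > 0")
      case True
      then have "(\<Sum>j\<in>I. z j) \<ge> 0" by (intro sum_nonneg) (auto intro: less_imp_le)
      then show ?thesis using False by (simp add: G_def gamma_weight_def)
    next
      case False
      then have "(\<Prod>j\<in>I. gamma_weight (a j) (z j)) = 0"
        using I by (auto simp: gamma_weight_def)
      then show ?thesis by (simp add: G_def)
    qed
    then show ?thesis using False by (simp add: gamma_weight_def)
  next
    case r: True
    let ?c = "ennreal (b powr A / Gamma A * (gamma_weight A r * exp (- b * r)))"
    have eq: "?c * H r y = ennreal (r ^ card I) * G r (\<lambda>j\<in>I. r * y j)" for y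
    proof (cases "y \<in> open_simplex K")
      case True
      then have y: "\<And>j. j \<in> I \<Longrightarrow> y j > 0" and s: "1 - (\<Sum>j\<in>I. y j) > 0"
        by (auto simp: open_simplex_def I_def)
      have sp: "simplex_point K y K = 1 - (\<Sum>j\<in>I. y j)" "\<And>j. j \<in> I \<Longrightarrow> simplex_point K y j = y j"
        using K by (auto simp: simplex_point_def I_def)
      have sum: "r - (\<Sum>j\<in>I. r * y j) = r * (1 - (\<Sum>j\<in>I. y j))"
        by (simp add: sum_distrib_left right_diff_distrib)
      have w: "gamma_weight (a j) (r * y j) = r powr (a j - 1) * y j powr (a j - 1)" if "j \<in> I" for j
        using r y[OF that] by (simp add: gamma_weight_def powr_mult)
      have wK: "gamma_weight (a K) (r * (1 - (\<Sum>j\<in>I. y j))) = r powr (a K - 1) * (1 - (\<Sum>j\<in>I. y j)) powr (a K - 1)"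
        using r s by (simp add: gamma_weight_def powr_mult)
      \<comment> \<open>Counting powers of \<open>r\<close>: the Jacobian contributes K - 1 and the
        weights contribute A - K, together the exponent A - 1 of the radial density.\<close>
      have "r ^ card I * ((\<Prod>j\<in>I. r powr (a j - 1)) * r powr (a K - 1)) = r powr (real (card I) + ((\<Sum>j\<in>I. a j - 1) + (a K - 1)))"
        using r I by (simp add: powr_add powr_realpow powr_sum)
      also have "real (card I) + ((\<Sum>j\<in>I. a j - 1) + (a K - 1)) = A - 1"
        using I by (simp add: A_def sum_subtractf)
      finally have rr: "r powr (A - 1) = r ^ card I * ((\<Prod>j\<in>I. r powr (a j - 1)) * r powr (a K - 1))" ..
      have fprod: "(\<Prod>j\<in>{1..K}. f j (r * simplex_point K y j)) = (\<Prod>j\<in>I. f j (r * y j)) * f K (r * (1 - (\<Sum>j\<in>I. y j)))"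
        using I sp by (simp add: mult.commute)
      have wprod: "(\<Prod>j\<in>{1..K}. simplex_point K y j powr (a j - 1))
          = (\<Prod>j\<in>I. y j powr (a j - 1)) * (1 - (\<Sum>j\<in>I. y j)) powr (a K - 1)"
        using I sp by (simp add: mult.commute)
      let ?F = "(\<Prod>j\<in>I. f j (r * y j)) * f K (r * (1 - (\<Sum>j\<in>I. y j)))"
      let ?X = "b powr A / Gamma A * (r powr (A - 1) * exp (- b * r))"
      let ?Y = "Gamma A / (\<Prod>j\<in>{1..K}. Gamma (a j)) * ((\<Prod>j\<in>I. y j powr (a j - 1)) * (1 - (\<Sum>j\<in>I. y j)) powr (a K - 1))"
      have "?c * H r y = ennreal ?X * (ennreal ?Y * ?F)"
        unfolding H_def fprod wprod gamma_weight_def using True r by simp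
      also have "\<dots> = ennreal (?X * ?Y) * ?F"
        using Gamma_real_pos[OF A] \<Gamma>P
        by (intro em mult_nonneg_nonneg divide_nonneg_nonneg prod_nonneg) (auto intro!: less_imp_le \<Gamma>)
      also have "?X * ?Y
       = r ^ card I * (C * exp (- b * r) * (\<Prod>j\<in>I. gamma_weight (a j) (r * y j)) * gamma_weight (a K) (r * (1 - (\<Sum>j\<in>I. y j))))"
        using Gamma_real_pos[OF A, THEN order_less_imp_not_eq2] by (simp add: C_def rr w wK prod.distrib)
      also have "ennreal \<dots> * ?F = ennreal (r ^ card I) * (ennreal (C * exp (- b * r)
          * (\<Prod>j\<in>I. gamma_weight (a j) (r * y j)) * gamma_weight (a K) (r * (1 - (\<Sum>j\<in>I. y j)))) * ?F)"
        using r C by (intro em[symmetric] mult_nonneg_nonneg prod_nonneg) auto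
      also have "\<dots> = ennreal (r ^ card I) * G r (\<lambda>j\<in>I. r * y j)"
        by (simp add: G_def sum)
      finally show ?thesis .
    next
      case False
      have "G r (\<lambda>j\<in>I. r * y j) = 0"
      proof (cases "\<forall>j\<in>I. y j > 0")
        case True
        then have "(\<Sum>j\<in>I. y j) \<ge> 1" using False by (auto simp: open_simplex_def I_def)
        then have "r * (\<Sum>j\<in>I. y j) \<ge> r" using r by simp
        then show ?thesis by (simp add: G_def gamma_weight_def sum_distrib_left)
      next
        case False
        then have "(\<Prod>j\<in>I. gamma_weight (a j) ((\<lambda>j\<in>I. r * y j) j)) = 0"
          using I r by (auto simp: gamma_weight_def zero_less_mult_iff)
        then show ?thesis by (simp add: G_def)
      qed
      then show ?thesis using False by (simp add: H_def)
    qed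
    have "?c * (\<integral>\<^sup>+x. (\<Prod>j\<in>{1..K}. f j (r * x j)) \<partial>dirichlet K a) = ?c * (\<integral>\<^sup>+y. H r y \<partial>?P)"
      by (simp only: D)
    also have "\<dots> = (\<integral>\<^sup>+y. ?c * H r y \<partial>?P)"
      by (rule nn_integral_cmult[symmetric]) (rule measurable_Pair2[OF H, simplified])
    also have "\<dots> = (\<integral>\<^sup>+y. ennreal (r ^ card I) * G r (\<lambda>j\<in>I. r * y j) \<partial>?P)"
      by (simp only: eq)
    also have "\<dots> = ennreal (r ^ card I) * (\<integral>\<^sup>+y. G r (\<lambda>j\<in>I. r * y j) \<partial>?P)"
      by (rule nn_integral_cmult) measurable
    also have "\<dots> = (\<integral>\<^sup>+z. G r z \<partial>?P)"
      by (rule nn_integral_PiM_lborel_scale[OF I(1) r]) measurable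
    finally show ?thesis .
  qed
  define k where "k j x = ennreal (gamma_weight (a j) x * exp (- b * x)) * f j x" for j x
  have km: "k j \<in> borel_measurable borel" if "j \<in> {1..K}" for j
    unfolding k_def using f[OF that] by measurable
  have gd: "(\<integral>\<^sup>+x. f j x \<partial>gamma_dist (a j) b) = ennreal (b powr a j / Gamma (a j)) * (\<integral>\<^sup>+x. k j x \<partial>lborel)"
    if "j \<in> {1..K}" for j
  proof -
    have "(\<integral>\<^sup>+x. f j x \<partial>gamma_dist (a j) b) = (\<integral>\<^sup>+x. ennreal (b powr a j / Gamma (a j)) * k j x \<partial>lborel)"
      unfolding nn_integral_gamma_dist[OF f[OF that]] k_def
      by (intro nn_integral_cong em[symmetric] divide_nonneg_nonneg less_imp_le[OF \<Gamma>[OF that]]) auto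
    then show ?thesis using km[OF that] by (simp add: nn_integral_cmult)
  qed
  \<comment> \<open>With \<open>w\<close> as last coordinate, \<open>r\<close> is the sum of all
    coordinates, so exp (- b r) factorizes over them. This is where the common rate enters. The form
    \<open>1 * w\<close> is that of the affine substitution rule.\<close>
  have shift: "G ((\<Sum>j\<in>I. z j) + 1 * w) z = ennreal C * ((\<Prod>j\<in>I. k j (z j)) * k K w)" for w z
  proof -
    have "exp (- b * ((\<Sum>j\<in>I. z j) + w)) = (\<Prod>j\<in>I. exp (- b * z j)) * exp (- b * w)"
      using I by (simp add: exp_sum[symmetric] exp_add[symmetric] sum_distrib_left sum_negf algebra_simps)
    moreover have "(\<Prod>j\<in>I. k j (z j)) = ennreal ((\<Prod>j\<in>I. gamma_weight (a j) (z j)) * (\<Prod>j\<in>I. exp (- b * z j))) * (\<Prod>j\<in>I. f j (z j))"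
      unfolding k_def prod.distrib[symmetric] by (subst prod_ennreal[symmetric]) (auto simp: prod.distrib)
    moreover have "(\<Prod>j\<in>I. gamma_weight (a j) (z j)) \<ge> 0" "(\<Prod>j\<in>I. exp (- b * z j)) \<ge> 0"
      by (auto intro!: prod_nonneg)
    ultimately show ?thesis
      using C by (simp add: G_def k_def ennreal_mult ac_simps)
  qed
  have "(\<integral>\<^sup>+r. \<integral>\<^sup>+x. (\<Prod>j\<in>{1..K}. f j (r * x j)) \<partial>dirichlet K a \<partial>gamma_dist A b)
    = (\<integral>\<^sup>+r. (\<integral>\<^sup>+z. G r z \<partial>?P) \<partial>lborel)"
    unfolding inner[symmetric] D
    by (rule nn_integral_gamma_dist) (use P.borel_measurable_nn_integral[OF H] in simp)
  also have "\<dots> = (\<integral>\<^sup>+z. (\<integral>\<^sup>+r. G r z \<partial>lborel) \<partial>?P)"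
    by (rule PS.Fubini'[symmetric]) measurable
  also have "\<dots> = (\<integral>\<^sup>+z. (\<integral>\<^sup>+w. G ((\<Sum>j\<in>I. z j) + 1 * w) z \<partial>lborel) \<partial>?P)"
  proof (rule nn_integral_cong)
    fix z assume "z \<in> space ?P"
    then have "(\<lambda>r. G r z) \<in> borel_measurable borel" by measurable
    from nn_integral_real_affine[OF this, of 1 "\<Sum>j\<in>I. z j"]
    show "(\<integral>\<^sup>+r. G r z \<partial>lborel) = (\<integral>\<^sup>+w. G ((\<Sum>j\<in>I. z j) + 1 * w) z \<partial>lborel)" by simp
  qed
  also have "\<dots> = (\<integral>\<^sup>+z. ennreal C * ((\<integral>\<^sup>+w. k K w \<partial>lborel) * (\<Prod>j\<in>I. k j (z j))) \<partial>?P)"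
    unfolding shift using km[of K] K
    by (simp add: nn_integral_cmult nn_integral_multc mult.commute)
  also have "\<dots> = ennreal C * ((\<integral>\<^sup>+w. k K w \<partial>lborel) * (\<integral>\<^sup>+z. (\<Prod>j\<in>I. k j (z j)) \<partial>?P))"
  proof -
    have "(\<lambda>z. \<Prod>j\<in>I. k j (z j)) \<in> borel_measurable ?P"
      using km by (intro borel_measurable_prod_ennreal measurable_compose[OF measurable_component_singleton]) (auto simp: I_def)
    then show ?thesis by (simp add: nn_integral_cmult)
  qed
  also have "(\<integral>\<^sup>+z. (\<Prod>j\<in>I. k j (z j)) \<partial>?P) = (\<Prod>j\<in>I. \<integral>\<^sup>+x. k j x \<partial>lborel)"
    using km by (intro product_nn_integral_prod) (auto simp: I_def)
  also have "(\<integral>\<^sup>+w. k K w \<partial>lborel) * \<dots> = (\<Prod>j\<in>{1..K}. \<integral>\<^sup>+x. k j x \<partial>lborel)"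
    using I by simp
  also have "ennreal C = (\<Prod>j\<in>{1..K}. ennreal (b powr a j / Gamma (a j)))"
    using \<Gamma> b by (subst prod_ennreal) (auto simp: C_def A_def prod_dividef powr_sum less_imp_le)
  also have "\<dots> * (\<Prod>j\<in>{1..K}. \<integral>\<^sup>+x. k j x \<partial>lborel) = (\<Prod>j\<in>{1..K}. \<integral>\<^sup>+x. f j x \<partial>gamma_dist (a j) b)"
    unfolding prod.distrib[symmetric] by (intro prod.cong refl gd[symmetric])
  finally show ?thesis unfolding A_def .
qed

section \<open>Mixtures\<close>

lemma sets_mixture [simp, measurable_cong]: "sets (mixture N I w \<mu>) = sets N"
  by (simp add: mixture_def sets.space_closed sets.sigma_sets_eq)

lemma space_mixture [simp]: "space (mixture N I w \<mu>) = space N"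
  using sets_eq_imp_space_eq[OF sets_mixture] .

lemma emeasure_mixture:
  fixes N :: "'a measure"
  assumes "\<And>i. i \<in> I \<Longrightarrow> sets (\<mu> i) = sets N" and A: "A \<in> sets N"
  shows "emeasure (mixture N I w \<mu>) A = (\<Sum>i\<in>I. ennreal (w i) * emeasure (\<mu> i) A)"
proof (rule emeasure_measure_of[OF mixture_def])
  show "sets N \<subseteq> Pow (space N)" by (rule sets.space_closed)
  show "positive (sets (mixture N I w \<mu>)) (\<lambda>A. \<Sum>i\<in>I. ennreal (w i) * emeasure (\<mu> i) A)"
    by (simp add: positive_def)
  show "countably_additive (sets (mixture N I w \<mu>)) (\<lambda>A. \<Sum>i\<in>I. ennreal (w i) * emeasure (\<mu> i) A)"
  proof (rule countably_additiveI)
    fix B :: "nat \<Rightarrow> 'a set"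
    assume B: "range B \<subseteq> sets (mixture N I w \<mu>)" "disjoint_family B"
    have "(\<Sum>n. \<Sum>i\<in>I. ennreal (w i) * emeasure (\<mu> i) (B n)) = (\<Sum>i\<in>I. \<Sum>n. ennreal (w i) * emeasure (\<mu> i) (B n))"
      by (rule suminf_sum) auto
    also have "\<dots> = (\<Sum>i\<in>I. ennreal (w i) * emeasure (\<mu> i) (\<Union>n. B n))"
      using B assms(1) by (intro sum.cong refl) (simp add: suminf_emeasure)
    finally show "(\<Sum>n. \<Sum>i\<in>I. ennreal (w i) * emeasure (\<mu> i) (B n)) = (\<Sum>i\<in>I. ennreal (w i) * emeasure (\<mu> i) (\<Union>n. B n))" .
  qed
qed (use A in simp)

text \<open>As a bind, a mixture inherits its integration rule from
  \<open>nn_integral_bind\<close>.\<close>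

lemma mixture_eq_bind_point_measure:
  assumes "finite I" "I \<noteq> {}" and \<mu>: "\<And>i. i \<in> I \<Longrightarrow> \<mu> i \<in> space (subprob_algebra N)"
  shows "mixture N I w \<mu> = point_measure I (\<lambda>i. ennreal (w i)) \<bind> \<mu>"
proof (rule measure_eqI)
  have m: "\<mu> \<in> point_measure I (\<lambda>i. ennreal (w i)) \<rightarrow>\<^sub>M subprob_algebra N"
    using \<mu> by simp
  then show "sets (mixture N I w \<mu>) = sets (point_measure I (\<lambda>i. ennreal (w i)) \<bind> \<mu>)"
    using sets_bind_measurable[OF m] assms(2) by (simp add: space_point_measure)
  fix A assume "A \<in> sets (mixture N I w \<mu>)"
  then show "emeasure (mixture N I w \<mu>) A = emeasure (point_measure I (\<lambda>i. ennreal (w i)) \<bind> \<mu>) A"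
    using assms \<mu> by (subst emeasure_bind[OF _ m])
      (auto simp: space_point_measure emeasure_mixture space_subprob_algebra nn_integral_point_measure_finite)
qed

lemma nn_integral_mixture:
  assumes "finite I" "I \<noteq> {}" and \<mu>: "\<And>i. i \<in> I \<Longrightarrow> \<mu> i \<in> space (subprob_algebra N)"
    and f: "f \<in> borel_measurable N"
  shows "(\<integral>\<^sup>+x. f x \<partial>mixture N I w \<mu>) = (\<Sum>i\<in>I. ennreal (w i) * (\<integral>\<^sup>+x. f x \<partial>\<mu> i))"
proof -
  have m: "\<mu> \<in> point_measure I (\<lambda>i. ennreal (w i)) \<rightarrow>\<^sub>M subprob_algebra N"
    using \<mu> by simp
  have "(\<integral>\<^sup>+x. f x \<partial>mixture N I w \<mu>) = (\<integral>\<^sup>+x. f x \<partial>(point_measure I (\<lambda>i. ennreal (w i)) \<bind> \<mu>))"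
    using mixture_eq_bind_point_measure[where w=w, OF assms(1,2) \<mu>] by simp
  also have "\<dots> = (\<Sum>i\<in>I. ennreal (w i) * (\<integral>\<^sup>+x. f x \<partial>\<mu> i))"
    by (simp add: nn_integral_bind[OF f m] nn_integral_point_measure_finite assms(1))
  finally show ?thesis .
qed

lemma gamma_dist_in_prob_algebra:
  "a > 0 \<Longrightarrow> b > 0 \<Longrightarrow> gamma_dist a b \<in> space (prob_algebra half_line)"
  by (simp add: space_prob_algebra prob_space_gamma_dist)

text \<open>The Dirichlet integral needs no separate computation: with all test functions equal to
  1, the substitution formula equates this mass with a product of masses of gamma laws.\<close>

lemma emeasure_dirichlet_space:
  assumes K: "K \<ge> 1" and a: "\<And>j. j \<in> {1..K} \<Longrightarrow> a j > 0"
  shows "emeasure (dirichlet K a) (space (orthant K)) = 1"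
proof -
  have A: "(\<Sum>j\<in>{1..K}. a j) > 0" using K a by (intro sum_pos) auto
  interpret g: prob_space "gamma_dist (\<Sum>j\<in>{1..K}. a j) 1" by (rule prob_space_gamma_dist) (use A in auto)
  have "(\<integral>\<^sup>+x. 1 \<partial>gamma_dist (a j) 1) = 1" if "j \<in> {1..K}" for j
    using prob_space.emeasure_space_1[OF prob_space_gamma_dist[of "a j" 1]] a[OF that] by simp
  then show ?thesis
    using nn_integral_gamma_dirichlet[of K a 1 "\<lambda>_ _. 1", OF K a] g.emeasure_space_1 by simp
qed

text \<open>Since all parameter vectors have the same sum \<open>A\<close>, a single radial law
  serves every component of the mixture. The sum over \<open>l\<close> can then be pulled out of the
  radial integral, and the substitution formula with indicators as test functions applies to each
  term.\<close>

lemma emeasure_gamma_times_mixture_dirichlet: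
  assumes K: "K \<ge> 1" and b: "b > 0" and L: "finite L"
    and a: "\<And>l j. l \<in> L \<Longrightarrow> j \<in> {1..K} \<Longrightarrow> a l j > 0"
    and A: "\<And>l. l \<in> L \<Longrightarrow> (\<Sum>j\<in>{1..K}. a l j) = A"
    and B: "\<And>j. j \<in> {1..K} \<Longrightarrow> B j \<in> sets half_line"
  shows "emeasure (gamma_times K A b (mixture (orthant K) L w (\<lambda>l. dirichlet K (a l)))) (Pi\<^sub>E {1..K} B)
     = (\<Sum>l\<in>L. ennreal (w l) * (\<Prod>j\<in>{1..K}. emeasure (gamma_dist (a l j) b) (B j)))"
proof -
  define \<nu> where "\<nu> = mixture (orthant K) L w (\<lambda>l. dirichlet K (a l))"
  define \<phi> :: "real \<times> (nat \<Rightarrow> real) \<Rightarrow> nat \<Rightarrow> real" where "\<phi> = (\<lambda>(r, x). \<lambda>j\<in>{1..K}. r * x j)"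
  let ?\<gamma> = "gamma_dist A b"
  have dir: "emeasure (dirichlet K (a l)) (space (orthant K)) = 1" if "l \<in> L" for l
    using K a that by (intro emeasure_dirichlet_space) auto
  have [simp]: "sets \<nu> = sets (orthant K)" "space \<nu> = space (orthant K)" by (simp_all add: \<nu>_def)
  have "emeasure \<nu> (space \<nu>) = (\<Sum>l\<in>L. ennreal (w l))"
    unfolding \<nu>_def by (simp add: emeasure_mixture dir)
  \<comment> \<open>The weights are arbitrary reals here, so the total mass is finite but not
    necessarily 1; finiteness supports the slicing formula below.\<close>
  then interpret \<nu>: finite_measure \<nu>
    by (intro finite_measureI) (simp add: L)
  have \<phi>: "\<phi> \<in> half_line \<Otimes>\<^sub>M orthant K \<rightarrow>\<^sub>M orthant K"
  proof -
    have "(\<lambda>p. \<phi> p j) \<in> half_line \<Otimes>\<^sub>M orthant K \<rightarrow>\<^sub>M half_line" if "j \<in> {1..K}" for j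
    proof (rule measurable_half_lineI)
      have "(\<lambda>p. fst p * snd p j) \<in> borel_measurable (half_line \<Otimes>\<^sub>M orthant K)"
        by (intro borel_measurable_times measurable_compose[OF measurable_fst measurable_half_line_borel]
            measurable_compose[OF measurable_snd orthant_component_measurable] that) auto
      then show "(\<lambda>p. \<phi> p j) \<in> borel_measurable (half_line \<Otimes>\<^sub>M orthant K)"
        using that by (simp add: \<phi>_def case_prod_beta)
    next
      fix p assume "p \<in> space (half_line \<Otimes>\<^sub>M orthant K)"
      then show "\<phi> p j \<ge> 0"
        using that by (auto simp: \<phi>_def space_pair_measure space_orthant PiE_iff)
    qed
    moreover have "\<phi> \<in> space (half_line \<Otimes>\<^sub>M orthant K) \<rightarrow> (\<Pi>\<^sub>E i\<in>{1..K}. space half_line)"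
      by (auto simp: \<phi>_def space_pair_measure space_orthant PiE_iff)
    ultimately show ?thesis
      unfolding orthant_def[of K] by (intro measurable_PiM_single') (auto simp: orthant_def)
  qed
  have PB: "Pi\<^sub>E {1..K} B \<in> sets (orthant K)"
    unfolding orthant_def by (rule sets_PiM_I_finite) (use B in auto)
  define X where "X = \<phi> -` Pi\<^sub>E {1..K} B \<inter> space (half_line \<Otimes>\<^sub>M orthant K)"
  have X: "X \<in> sets (half_line \<Otimes>\<^sub>M orthant K)"
    unfolding X_def by (rule measurable_sets[OF \<phi> PB])
  have setseq: "sets (?\<gamma> \<Otimes>\<^sub>M M) = sets (half_line \<Otimes>\<^sub>M orthant K)" if "sets M = sets (orthant K)" for M
    by (rule sets_pair_measure_cong) (use that in auto)
  have slice: "Pair r -` X \<in> sets (orthant K)" for r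
    using X by (rule sets_Pair1)
  have D: "emeasure (dirichlet K (a l)) (Pair r -` X)
      = (\<integral>\<^sup>+x. (\<Prod>j\<in>{1..K}. indicator (B j) (r * x j)) \<partial>dirichlet K (a l))" if "r \<ge> 0" for r l
  proof -
    have "emeasure (dirichlet K (a l)) (Pair r -` X) = (\<integral>\<^sup>+x. indicator (Pair r -` X) x \<partial>dirichlet K (a l))"
      using slice by simp
    also have "\<dots> = (\<integral>\<^sup>+x. (\<Prod>j\<in>{1..K}. indicator (B j) (r * x j)) \<partial>dirichlet K (a l))"
    proof (rule nn_integral_cong)
      fix x assume "x \<in> space (dirichlet K (a l))"
      then have "x \<in> space (orthant K)" by simp
      then have "(x \<in> Pair r -` X) = (\<forall>j\<in>{1..K}. r * x j \<in> B j)"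
        using that by (auto simp: X_def \<phi>_def space_pair_measure PiE_iff)
      then show "indicator (Pair r -` X) x = (\<Prod>j\<in>{1..K}. indicator (B j) (r * x j) :: ennreal)"
        by (auto simp: indicator_def)
    qed
    finally show ?thesis .
  qed
  have "emeasure (gamma_times K A b \<nu>) (Pi\<^sub>E {1..K} B) = emeasure (?\<gamma> \<Otimes>\<^sub>M \<nu>) X"
  proof -
    have "\<phi> \<in> ?\<gamma> \<Otimes>\<^sub>M \<nu> \<rightarrow>\<^sub>M orthant K"
      using \<phi> measurable_cong_sets[OF setseq[of \<nu>] refl, of "orthant K"] by auto
    then show ?thesis
      unfolding gamma_times_def \<phi>_def[symmetric]
      using PB sets_eq_imp_space_eq[OF setseq[of \<nu>]] by (subst emeasure_distr) (auto simp: X_def)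
  qed
  also have "\<dots> = (\<integral>\<^sup>+r. emeasure \<nu> (Pair r -` X) \<partial>?\<gamma>)"
    using X setseq[of \<nu>] by (intro \<nu>.emeasure_pair_measure_alt) simp
  also have "\<dots> = (\<integral>\<^sup>+r. (\<Sum>l\<in>L. ennreal (w l) * emeasure (dirichlet K (a l)) (Pair r -` X)) \<partial>?\<gamma>)"
    unfolding \<nu>_def by (intro nn_integral_cong emeasure_mixture slice) simp
  also have "\<dots> = (\<Sum>l\<in>L. ennreal (w l) * (\<integral>\<^sup>+r. emeasure (dirichlet K (a l)) (Pair r -` X) \<partial>?\<gamma>))"
  proof -
    have "(\<lambda>r. emeasure (dirichlet K (a l)) (Pair r -` X)) \<in> borel_measurable ?\<gamma>" if "l \<in> L" for l
    proof -
      interpret d: finite_measure "dirichlet K (a l)"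
        by (rule finite_measureI) (use dir[OF that] in simp)
      show ?thesis
        using X setseq[of "dirichlet K (a l)"] by (intro d.measurable_emeasure_Pair) simp
    qed
    then show ?thesis by (simp add: nn_integral_sum nn_integral_cmult)
  qed
  also have "\<dots> = (\<Sum>l\<in>L. ennreal (w l) * (\<Prod>j\<in>{1..K}. emeasure (gamma_dist (a l j) b) (B j)))"
  proof (intro sum.cong refl arg_cong2[where f = "(*)"])
    fix l assume l: "l \<in> L"
    have "(\<integral>\<^sup>+r. emeasure (dirichlet K (a l)) (Pair r -` X) \<partial>?\<gamma>)
      = (\<integral>\<^sup>+r. (\<integral>\<^sup>+x. (\<Prod>j\<in>{1..K}. indicator (B j) (r * x j)) \<partial>dirichlet K (a l)) \<partial>gamma_dist (\<Sum>j\<in>{1..K}. a l j) b)"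
      unfolding A[OF l] by (intro nn_integral_cong D) simp
    also have "\<dots> = (\<Prod>j\<in>{1..K}. \<integral>\<^sup>+x. indicator (B j) x \<partial>gamma_dist (a l j) b)"
      by (rule nn_integral_gamma_dirichlet[OF K a[OF l] b])
        (auto intro!: borel_measurable_indicator sets_half_line_borel[OF B])
    also have "\<dots> = (\<Prod>j\<in>{1..K}. emeasure (gamma_dist (a l j) b) (B j))"
      using B by (intro prod.cong refl nn_integral_indicator) simp
    finally show "(\<integral>\<^sup>+r. emeasure (dirichlet K (a l)) (Pair r -` X) \<partial>?\<gamma>)
      = (\<Prod>j\<in>{1..K}. emeasure (gamma_dist (a l j) b) (B j))" .
  qed
  finally show ?thesis by (simp add: \<nu>_def)
qed

section \<open>Prediction of a gamma law in one dimension\<close>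

lemma binomial_prob_nonneg: "0 \<le> p \<Longrightarrow> p \<le> 1 \<Longrightarrow> binomial_prob k n p \<ge> 0"
  by (simp add: binomial_prob_def)

lemma binomial_prob_diff:
  assumes "k \<le> n"
  shows "binomial_prob (n - k) n p = real (n choose k) * p ^ (n - k) * (1 - p) ^ k"
  using assms by (simp add: binomial_prob_def binomial_symmetric[symmetric])

text \<open>Generating function of the number \<open>n - k\<close> of successes. It is used at
  \<open>q = 1\<close> for the total mass and at the transform of the exponential law for the
  mixture.\<close>

lemma sum_binomial_prob_diff:
  "(\<Sum>k\<in>{0..n}. binomial_prob (n - k) n p * q ^ (n - k)) = (p * q + 1 - p) ^ n"
proof -
  have "(\<Sum>k\<in>{0..n}. binomial_prob (n - k) n p * q ^ (n - k))
    = (\<Sum>k\<le>n. real (n choose k) * (1 - p) ^ k * (p * q) ^ (n - k))"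
    by (rule sum.cong) (auto simp: binomial_prob_diff power_mult_distrib)
  also have "\<dots> = ((1 - p) + p * q) ^ n"
    by (rule binomial_ring[symmetric])
  finally show ?thesis by (simp add: algebra_simps)
qed

text \<open>Passing to the decaying exponential, which lies in (0,1] and is the variable of
  \<open>cir_den\<close>, makes both the bounds on \<open>p_coeff\<close> and the comparison with
  \<open>cir_den\<close> elementary.\<close>

lemma p_coeff_eq:
  "p_coeff \<beta> s t = \<beta> * exp (- \<beta> * t / 2) / (\<beta> + s - s * exp (- \<beta> * t / 2))"
proof -
  have "(\<beta> + s) * exp (\<beta> * t / 2) - s = (\<beta> + s - s * exp (- \<beta> * t / 2)) * exp (\<beta> * t / 2)"
    by (simp add: left_diff_distrib mult.assoc exp_add[symmetric])
  moreover have "\<beta> = \<beta> * exp (- \<beta> * t / 2) * exp (\<beta> * t / 2)"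
    by (simp add: mult.assoc exp_add[symmetric])
  ultimately show ?thesis
    unfolding p_coeff_def by (metis exp_not_eq_zero nonzero_mult_divide_mult_cancel_right)
qed

lemma S_coeff_eq: "S_coeff \<beta> s t = s * p_coeff \<beta> s t"
  by (simp add: S_coeff_def p_coeff_def)

lemma p_coeff_bounds:
  assumes "\<beta> > 0" "s \<ge> 0" "t \<ge> 0"
  shows "0 \<le> p_coeff \<beta> s t" "p_coeff \<beta> s t \<le> 1"
proof -
  define e where "e = exp (- \<beta> * t / 2)"
  have e: "0 < e" "e \<le> 1" using assms by (simp_all add: e_def)
  have "s * e \<le> s * 1" using e assms by (intro mult_left_mono) auto
  then have pos: "\<beta> + s - s * e > 0" using assms by simp
  then show "0 \<le> p_coeff \<beta> s t"
    unfolding p_coeff_eq e_def[symmetric] using e assms by simp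
  have "(\<beta> + s) * e \<le> (\<beta> + s) * 1" using e assms by (intro mult_left_mono) auto
  then show "p_coeff \<beta> s t \<le> 1"
    unfolding p_coeff_eq e_def[symmetric] using pos by (simp add: algebra_simps)
qed

text \<open>Both the quotient with \<open>cir_rate\<close> and the binomial generating function p q
  + 1 - p equal D q. The left side is thus D^(-a) (D q)^(a + m) = q^a (p q + 1 - p)^m, and expanding
  the power gives the sum.\<close>

lemma cir_gamma_laplace_identity:
  assumes "\<beta> > 0" "s \<ge> 0" "t \<ge> 0" "c > 0" and b: "b = \<beta> + S_coeff \<beta> s t"
  shows "cir_den \<beta> c t powr (- a) * ((\<beta> + s) / (\<beta> + s + cir_rate \<beta> c t)) powr (a + real m)
    = (\<Sum>k\<in>{0..m}. binomial_prob (m - k) m (p_coeff \<beta> s t) * (b / (b + c)) powr (a + real m - real k))"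
proof -
  define e where "e = exp (- \<beta> * t / 2)"
  define D where "D = cir_den \<beta> c t"
  define p where "p = p_coeff \<beta> s t"
  define q where "q = b / (b + c)"
  have e: "0 < e" "e \<le> 1" using assms by (simp_all add: e_def)
  have D: "D > 0" using cir_den_ge_1[of \<beta> c t] assms by (simp add: D_def)
  have D_eq: "D = 1 + c / \<beta> * (1 - e)" by (simp add: D_def cir_den_def e_def)
  have se: "s * e \<le> s * 1" using e assms by (intro mult_left_mono) auto
  define N where "N = \<beta> + s - s * e"
  have N: "N > 0" using se assms by (simp add: N_def)
  have p: "p = \<beta> * e / N" by (simp add: p_def p_coeff_eq e_def N_def)
  have bN: "b = \<beta> * (\<beta> + s) / N"
    using N unfolding b S_coeff_eq p_def[symmetric] p by (simp add: field_simps N_def)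
  have M: "\<beta> * (\<beta> + s) + c * N > 0" using N assms by (intro add_pos_nonneg) auto
  have q: "q = \<beta> * (\<beta> + s) / (\<beta> * (\<beta> + s) + c * N)"
  proof -
    have "b + c = (\<beta> * (\<beta> + s) + c * N) / N" unfolding bN using N by (simp add: add_divide_distrib)
    then show ?thesis unfolding q_def bN using N by simp
  qed
  have q0: "q > 0" using M assms unfolding q by simp
  \<comment> \<open>The one polynomial identity behind both \<open>Dq\<close> and
    \<open>ratio\<close>; its right side is the common denominator of \<open>q\<close> and p (1 -
    q).\<close>
  have DM: "\<beta> * D * (\<beta> + s) + \<beta> * c * e = \<beta> * (\<beta> + s) + c * N"
    using assms by (simp add: D_eq N_def field_simps)
  have Dq: "D * q = p * q + 1 - p"
  proof -
    have "1 - q = c * N / (\<beta> * (\<beta> + s) + c * N)"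
      unfolding q using M by (simp add: field_simps)
    then have "p * (1 - q) = \<beta> * e * c / (\<beta> * (\<beta> + s) + c * N)"
      unfolding p using N by simp
    then have "1 - p * (1 - q) = (\<beta> * D * (\<beta> + s)) / (\<beta> * (\<beta> + s) + c * N)"
      using M DM by (simp add: field_simps)
    also have "\<dots> = D * q" unfolding q by simp
    finally show ?thesis by (simp add: algebra_simps)
  qed
  have ratio: "(\<beta> + s) / (\<beta> + s + cir_rate \<beta> c t) = D * q"
  proof -
    have "D * cir_rate \<beta> c t = c * e" using D by (simp add: cir_rate_def D_def e_def)
    then have "D * (\<beta> + s) + c * e = D * (\<beta> + s + cir_rate \<beta> c t)" by (simp add: distrib_left)
    then have "(\<beta> + s) / (\<beta> + s + cir_rate \<beta> c t) = D * (\<beta> + s) / (D * (\<beta> + s) + c * e)"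
      using D by simp
    also have "\<dots> = \<beta> * (D * (\<beta> + s)) / (\<beta> * (D * (\<beta> + s) + c * e))" using assms by simp
    also have "\<beta> * (D * (\<beta> + s) + c * e) = \<beta> * (\<beta> + s) + c * N" using DM by (simp add: algebra_simps)
    finally show ?thesis unfolding q by (simp add: ac_simps)
  qed
  have "(\<Sum>k\<in>{0..m}. binomial_prob (m - k) m p * q powr (a + real m - real k))
      = (\<Sum>k\<in>{0..m}. q powr a * (binomial_prob (m - k) m p * q ^ (m - k)))"
  proof (rule sum.cong)
    fix k assume "k \<in> {0..m}"
    then have "q powr (a + real m - real k) = q powr a * q ^ (m - k)"
      using q0 by (simp add: powr_add[symmetric] powr_realpow[symmetric] add_diff_eq)
    then show "binomial_prob (m - k) m p * q powr (a + real m - real k) = q powr a * (binomial_prob (m - k) m p * q ^ (m - k))"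
      by simp
  qed simp
  also have "\<dots> = q powr a * (D * q) ^ m"
    by (simp add: sum_distrib_left[symmetric] sum_binomial_prob_diff Dq)
  also have "\<dots> = D powr (- a) * (D * q) powr (a + real m)"
    using D q0 by (simp add: powr_add powr_realpow powr_mult powr_minus power_mult_distrib field_simps)
  finally show ?thesis
    unfolding ratio D_def p_def q_def by simp
qed

lemma cir_kernel_laplace:
  assumes P: "cir_semigroup \<alpha> \<beta> P" and "\<beta> > 0" "c > 0" "t \<ge> 0" "x \<ge> 0"
  shows "(\<integral>\<^sup>+y. ennreal (exp (- c * y)) \<partial>P t x) = ennreal (cir_den \<beta> c t powr (- \<alpha>) * exp (- cir_rate \<beta> c t * x))"
proof -
  have "feller_semigroup P" using P by (simp add: cir_semigroup_def)
  moreover have "(\<lambda>x. exp (- c * x)) \<in> C0" using affine_mult_exp_neg_C0[OF assms(3), of 1 0] by simp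
  ultimately have "integrable (P t x) (\<lambda>x. exp (- c * x))"
    using assms by (intro feller_integrable)
  then have "(\<integral>\<^sup>+y. ennreal (exp (- c * y)) \<partial>P t x) = ennreal (\<integral>y. exp (- c * y) \<partial>P t x)"
    by (rule nn_integral_eq_integral) simp
  then show ?thesis using cir_laplace[OF assms] by simp
qed

text \<open>The transform depends on \<alpha> and \<beta> alone. This allows the semigroup hidden in
  each \<open>cir_process\<close> to be exchanged for a fixed one.\<close>

lemma cir_kernel_unique:
  assumes "cir_semigroup \<alpha> \<beta> P" "cir_semigroup \<alpha> \<beta> Q" "\<beta> > 0" "t \<ge> 0" "x \<ge> 0"
  shows "P t x = Q t x"
proof (rule half_line_eqI_laplace)
  have P: "feller_semigroup P" "feller_semigroup Q" using assms by (auto simp: cir_semigroup_def)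
  show "prob_space (P t x)" "prob_space (Q t x)" "sets (P t x) = sets half_line" "sets (Q t x) = sets half_line"
    using feller_prob[OF P(1)] feller_prob[OF P(2)] assms by auto
  fix c :: real assume "c > 0"
  then show "(\<integral>\<^sup>+y. ennreal (exp (- c * y)) \<partial>P t x) = (\<integral>\<^sup>+y. ennreal (exp (- c * y)) \<partial>Q t x)"
    using assms by (simp only: cir_kernel_laplace)
qed

text \<open>The transform of the kernel is itself exponential in the starting point, so averaging
  over the gamma law just evaluates the gamma transform at \<open>cir_rate\<close>. No density of
  the kernel enters.\<close>

lemma gamma_dist_bind_cir:
  assumes P: "cir_semigroup \<alpha> \<beta> P" and "\<alpha> > 0" "\<beta> > 0" "s \<ge> 0" "t \<ge> 0"
  shows "gamma_dist (\<alpha> + real m) (\<beta> + s) \<bind> P t =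
    mixture half_line {0..m} (\<lambda>k. binomial_prob (m - k) m (p_coeff \<beta> s t))
      (\<lambda>k. gamma_dist (\<alpha> + real m - real k) (\<beta> + S_coeff \<beta> s t))"
proof (rule half_line_eqI_laplace)
  let ?p = "p_coeff \<beta> s t" and ?b = "\<beta> + S_coeff \<beta> s t"
  note pb = p_coeff_bounds[OF assms(3,4,5)]
  have b: "?b > 0" using assms pb by (simp add: S_coeff_eq add_pos_nonneg)
  have feller: "feller_semigroup P" using P by (simp add: cir_semigroup_def)
  have Pm: "P t \<in> half_line \<rightarrow>\<^sub>M prob_algebra half_line"
    by (rule feller_prob_algebra) fact+
  have g: "gamma_dist (\<alpha> + real m) (\<beta> + s) \<in> space (prob_algebra half_line)"
    using assms by (intro gamma_dist_in_prob_algebra) auto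
  show "prob_space (gamma_dist (\<alpha> + real m) (\<beta> + s) \<bind> P t)"
    by (rule prob_space_bind'[OF g Pm])
  show "sets (gamma_dist (\<alpha> + real m) (\<beta> + s) \<bind> P t) = sets half_line"
    by (rule sets_bind'[OF g Pm])
  have gk: "gamma_dist (\<alpha> + real m - real k) ?b \<in> space (prob_algebra half_line)" if "k \<in> {0..m}" for k
    using that assms b by (intro gamma_dist_in_prob_algebra) auto
  then have gs: "gamma_dist (\<alpha> + real m - real k) ?b \<in> space (subprob_algebra half_line)" if "k \<in> {0..m}" for k
    using that by (auto simp: space_prob_algebra space_subprob_algebra prob_space_imp_subprob_space)
  have "emeasure (gamma_dist (\<alpha> + real m - real k) ?b) {0..} = 1" if "k \<in> {0..m}" for k
    using prob_space.emeasure_space_1[of "gamma_dist (\<alpha> + real m - real k) ?b"] gk[OF that]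
    by (simp add: space_prob_algebra)
  then have "emeasure (mixture half_line {0..m} (\<lambda>k. binomial_prob (m - k) m ?p) (\<lambda>k. gamma_dist (\<alpha> + real m - real k) ?b)) {0..}
      = (\<Sum>k\<in>{0..m}. ennreal (binomial_prob (m - k) m ?p))"
    using sets.top[of half_line] by (subst emeasure_mixture) auto
  \<comment> \<open>The factor \<open>1 ^ (m - k)\<close> brings the sum into the form of the
    generating function at \<open>q = 1\<close>.\<close>
  also have "\<dots> = ennreal (\<Sum>k\<in>{0..m}. binomial_prob (m - k) m ?p * 1 ^ (m - k))"
    using pb by (simp add: binomial_prob_nonneg sum_ennreal)
  also have "\<dots> = 1" by (subst sum_binomial_prob_diff) simp
  finally show "prob_space (mixture half_line {0..m} (\<lambda>k. binomial_prob (m - k) m ?p) (\<lambda>k. gamma_dist (\<alpha> + real m - real k) ?b))"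
    by (intro prob_spaceI) simp
  fix c :: real assume c: "c > 0"
  let ?r = "cir_rate \<beta> c t" and ?D = "cir_den \<beta> c t"
  have e: "(\<lambda>x. ennreal (exp (- c * x))) \<in> borel_measurable half_line" for c :: real
    by (rule measurable_half_line_borel) simp
  have r: "?r > 0" using assms c by (intro cir_rate_pos) auto
  have "(\<integral>\<^sup>+x. ennreal (exp (- c * x)) \<partial>(gamma_dist (\<alpha> + real m) (\<beta> + s) \<bind> P t))
    = (\<integral>\<^sup>+x. (\<integral>\<^sup>+y. ennreal (exp (- c * y)) \<partial>P t x) \<partial>gamma_dist (\<alpha> + real m) (\<beta> + s))"
    using measurable_prob_algebraD[OF Pm] measurable_cong_sets[OF sets_gamma_dist refl]
    by (intro nn_integral_bind[OF e]) blast
  also have "\<dots> = (\<integral>\<^sup>+x. ennreal (?D powr (- \<alpha>)) * ennreal (exp (- ?r * x)) \<partial>gamma_dist (\<alpha> + real m) (\<beta> + s))"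
    using P assms c by (intro nn_integral_cong) (simp add: cir_kernel_laplace[simplified] ennreal_mult)
  also have "\<dots> = ennreal (?D powr (- \<alpha>)) * ennreal (((\<beta> + s) / (\<beta> + s + ?r)) powr (\<alpha> + real m))"
    using assms r e[of ?r] by (subst nn_integral_cmult) (auto simp: gamma_dist_laplace[simplified] cong: measurable_cong_sets)
  also have "\<dots> = ennreal (\<Sum>k\<in>{0..m}. binomial_prob (m - k) m ?p * (?b / (?b + c)) powr (\<alpha> + real m - real k))"
    unfolding cir_gamma_laplace_identity[OF assms(3,4,5) c refl, symmetric] by (simp add: ennreal_mult)
  also have "\<dots> = (\<Sum>k\<in>{0..m}. ennreal (binomial_prob (m - k) m ?p) * (\<integral>\<^sup>+x. ennreal (exp (- c * x)) \<partial>gamma_dist (\<alpha> + real m - real k) ?b))"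
  proof -
    have "(\<integral>\<^sup>+x. ennreal (exp (- c * x)) \<partial>gamma_dist (\<alpha> + real m - real k) ?b) = ennreal ((?b / (?b + c)) powr (\<alpha> + real m - real k))"
      if "k \<in> {0..m}" for k
      using that assms b c by (intro gamma_dist_laplace) auto
    then show ?thesis
      using pb by (subst sum_ennreal[symmetric]) (auto simp: binomial_prob_nonneg ennreal_mult)
  qed
  also have "\<dots> = (\<integral>\<^sup>+x. ennreal (exp (- c * x)) \<partial>mixture half_line {0..m} (\<lambda>k. binomial_prob (m - k) m ?p) (\<lambda>k. gamma_dist (\<alpha> + real m - real k) ?b))"
    by (rule nn_integral_mixture[symmetric]) (use gs e in auto)
  finally show "(\<integral>\<^sup>+x. ennreal (exp (- c * x)) \<partial>(gamma_dist (\<alpha> + real m) (\<beta> + s) \<bind> P t))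
    = (\<integral>\<^sup>+x. ennreal (exp (- c * x)) \<partial>mixture half_line {0..m} (\<lambda>k. binomial_prob (m - k) m ?p) (\<lambda>k. gamma_dist (\<alpha> + real m - real k) ?b))" .
qed simp

section \<open>Products of kernels and the joint process\<close>

text \<open>The product locales require all factors, also those outside of \<open>I\<close>, to be probability spaces.\<close>

lemma PiM_prob_space_extension:
  assumes "\<And>i. i \<in> I \<Longrightarrow> prob_space (M i)"
  obtains M' where "product_prob_space M'" "PiM I M' = PiM I M" "\<And>i. i \<in> I \<Longrightarrow> M' i = M i"
proof
  let ?M' = "\<lambda>i. if i \<in> I then M i else return (count_space UNIV) undefined"
  show "product_prob_space ?M'"
    by (rule product_prob_spaceI) (use assms in \<open>auto intro: prob_space_return\<close>)
  show "PiM I ?M' = PiM I M" by (rule PiM_cong) auto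
qed simp

lemma PiM_prob_eqI:
  assumes "finite I" "\<And>i. i \<in> I \<Longrightarrow> prob_space (M i)" "sets P = sets (PiM I M)"
    and "\<And>A. (\<And>i. i \<in> I \<Longrightarrow> A i \<in> sets (M i)) \<Longrightarrow> emeasure P (Pi\<^sub>E I A) = (\<Prod>i\<in>I. emeasure (M i) (A i))"
  shows "P = PiM I M"
proof -
  obtain M' where M': "product_prob_space M'" "PiM I M' = PiM I M" "\<And>i. i \<in> I \<Longrightarrow> M' i = M i"
    using PiM_prob_space_extension[of I M] assms(2) by blast
  interpret product_prob_space M' by fact
  have "P = PiM I M'"
    by (rule PiM_eqI) (use assms M' in auto)
  then show ?thesis using M'(2) by simp
qed

lemma emeasure_PiM_prob:
  assumes "finite I" "\<And>i. i \<in> I \<Longrightarrow> prob_space (M i)" "\<And>i. i \<in> I \<Longrightarrow> A i \<in> sets (M i)"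
  shows "emeasure (PiM I M) (Pi\<^sub>E I A) = (\<Prod>i\<in>I. emeasure (M i) (A i))"
proof -
  obtain M' where M': "product_prob_space M'" "PiM I M' = PiM I M" "\<And>i. i \<in> I \<Longrightarrow> M' i = M i"
    using PiM_prob_space_extension[of I M] assms(2) by blast
  interpret product_prob_space M' by fact
  have "emeasure (PiM I M') (Pi\<^sub>E I A) = (\<Prod>i\<in>I. emeasure (M' i) (A i))"
    by (rule emeasure_PiM) (use assms M' in auto)
  then show ?thesis using M' by simp
qed

lemma nn_integral_PiM_prob_prod:
  assumes "finite I" "\<And>i. i \<in> I \<Longrightarrow> prob_space (M i)" "\<And>i. i \<in> I \<Longrightarrow> f i \<in> borel_measurable (M i)"
  shows "(\<integral>\<^sup>+x. (\<Prod>i\<in>I. f i (x i)) \<partial>PiM I M) = (\<Prod>i\<in>I. \<integral>\<^sup>+x. f i x \<partial>M i)"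
proof -
  obtain M' where M': "product_prob_space M'" "PiM I M' = PiM I M" "\<And>i. i \<in> I \<Longrightarrow> M' i = M i"
    using PiM_prob_space_extension[of I M] assms(2) by blast
  interpret product_prob_space M' by fact
  have "(\<integral>\<^sup>+x. (\<Prod>i\<in>I. f i (x i)) \<partial>PiM I M') = (\<Prod>i\<in>I. \<integral>\<^sup>+x. f i x \<partial>M' i)"
    by (rule product_nn_integral_prod) (use assms M' in auto)
  then show ?thesis using M' by simp
qed

section \<open>Finite products of Markov kernels\<close>

lemma prob_kernelD:
  assumes "\<kappa> \<in> M \<rightarrow>\<^sub>M prob_algebra N" "x \<in> space M"
  shows "prob_space (\<kappa> x)" "sets (\<kappa> x) = sets N"
  using measurable_space[OF assms] by (auto simp: space_prob_algebra)

lemma emeasure_prob_kernel_measurable: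
  assumes "\<kappa> \<in> M \<rightarrow>\<^sub>M prob_algebra N" "A \<in> sets N"
  shows "(\<lambda>x. emeasure (\<kappa> x) A) \<in> borel_measurable M"
  using measurable_compose[OF measurable_prob_algebraD[OF assms(1)] measurable_emeasure_subprob_algebra[OF assms(2)]] .

text \<open>Boxes generate the product space and are stable under intersection; on a box the value
  is a finite product of measurable functions of single coordinates.\<close>

lemma measurable_PiM_kernel:
  assumes I: "finite I" and \<kappa>: "\<And>i. i \<in> I \<Longrightarrow> \<kappa> i \<in> M i \<rightarrow>\<^sub>M prob_algebra (N i)"
  shows "(\<lambda>z. \<Pi>\<^sub>M i\<in>I. \<kappa> i (z i)) \<in> PiM I M \<rightarrow>\<^sub>M prob_algebra (PiM I N)"
proof (rule measurable_prob_algebra_generated[OF sets_PiM Int_stable_prod_algebra prod_algebra_sets_into_space])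
  fix z assume z: "z \<in> space (PiM I M)"
  then have zi: "z i \<in> space (M i)" if "i \<in> I" for i using that by (auto simp: space_PiM)
  show "prob_space (\<Pi>\<^sub>M i\<in>I. \<kappa> i (z i))"
    by (rule prob_space_PiM) (rule prob_kernelD[OF \<kappa> zi])
  show "sets (\<Pi>\<^sub>M i\<in>I. \<kappa> i (z i)) = sets (PiM I N)"
    by (intro sets_PiM_cong refl prob_kernelD[OF \<kappa> zi])
next
  fix A assume "A \<in> prod_algebra I N"
  then obtain E where E: "A = Pi\<^sub>E I E" "E \<in> (\<Pi> i\<in>I. sets (N i))" by (rule prod_algebraE_all)
  have "(\<lambda>z. emeasure (\<kappa> i (z i)) (E i)) \<in> borel_measurable (PiM I M)" if "i \<in> I" for i
    by (rule measurable_compose[OF measurable_component_singleton[OF that], of "\<lambda>x. emeasure (\<kappa> i x) (E i)"])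
      (use that E(2) in \<open>auto intro: emeasure_prob_kernel_measurable[OF \<kappa>]\<close>)
  then have "(\<lambda>z. \<Prod>i\<in>I. emeasure (\<kappa> i (z i)) (E i)) \<in> borel_measurable (PiM I M)"
    by (rule borel_measurable_prod_ennreal)
  moreover have "emeasure (\<Pi>\<^sub>M i\<in>I. \<kappa> i (z i)) A = (\<Prod>i\<in>I. emeasure (\<kappa> i (z i)) (E i))"
    if "z \<in> space (PiM I M)" for z
  proof -
    have zi: "z i \<in> space (M i)" if "i \<in> I" for i
      using that \<open>z \<in> space (PiM I M)\<close> by (auto simp: space_PiM)
    show ?thesis
      unfolding E(1) by (rule emeasure_PiM_prob) (use I E(2) prob_kernelD[OF \<kappa> zi] in auto)
  qed
  ultimately show "(\<lambda>z. emeasure (\<Pi>\<^sub>M i\<in>I. \<kappa> i (z i)) A) \<in> borel_measurable (PiM I M)"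
    by (subst measurable_cong) auto
qed

text \<open>Independent coordinates moved by independent kernels stay independent. On a box the
  kernel value is a product of functions of single coordinates, and the integral of such a product
  factorizes.\<close>

lemma bind_PiM_kernel:
  assumes I: "finite I" and \<kappa>: "\<And>i. i \<in> I \<Longrightarrow> \<kappa> i \<in> M i \<rightarrow>\<^sub>M prob_algebra (N i)"
    and G: "\<And>i. i \<in> I \<Longrightarrow> G i \<in> space (prob_algebra (M i))"
  shows "PiM I G \<bind> (\<lambda>z. \<Pi>\<^sub>M i\<in>I. \<kappa> i (z i)) = (\<Pi>\<^sub>M i\<in>I. G i \<bind> \<kappa> i)"
proof (rule PiM_prob_eqI[OF I])
  have Gp: "prob_space (G i)" and Gs: "sets (G i) = sets (M i)" if "i \<in> I" for i
    using G[OF that] by (auto simp: space_prob_algebra)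
  have GM: "sets (PiM I G) = sets (PiM I M)" by (intro sets_PiM_cong refl Gs)
  have "prob_space (PiM I G)" by (rule prob_space_PiM) (rule Gp)
  then have PG: "PiM I G \<in> space (prob_algebra (PiM I M))" using GM by (simp add: space_prob_algebra)
  have K: "(\<lambda>z. \<Pi>\<^sub>M i\<in>I. \<kappa> i (z i)) \<in> PiM I M \<rightarrow>\<^sub>M prob_algebra (PiM I N)"
    by (rule measurable_PiM_kernel[OF I \<kappa>])
  have sb: "sets (G i \<bind> \<kappa> i) = sets (N i)" if "i \<in> I" for i
    by (rule sets_bind'[OF G[OF that] \<kappa>[OF that]])
  show "prob_space (G i \<bind> \<kappa> i)" if "i \<in> I" for i
    by (rule prob_space_bind'[OF G[OF that] \<kappa>[OF that]])
  show "sets (PiM I G \<bind> (\<lambda>z. \<Pi>\<^sub>M i\<in>I. \<kappa> i (z i))) = sets (\<Pi>\<^sub>M i\<in>I. G i \<bind> \<kappa> i)"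
    by (rule trans[OF sets_bind'[OF PG K]]) (intro sets_PiM_cong refl sb[symmetric])
  fix A assume "\<And>i. i \<in> I \<Longrightarrow> A i \<in> sets (G i \<bind> \<kappa> i)"
  then have A: "A i \<in> sets (N i)" if "i \<in> I" for i using sb that by auto
  have \<kappa>G: "\<kappa> i \<in> G i \<rightarrow>\<^sub>M subprob_algebra (N i)" if "i \<in> I" for i
    unfolding measurable_cong_sets[OF Gs[OF that] refl] by (rule measurable_prob_algebraD[OF \<kappa>[OF that]])
  have KG: "(\<lambda>z. \<Pi>\<^sub>M i\<in>I. \<kappa> i (z i)) \<in> PiM I G \<rightarrow>\<^sub>M subprob_algebra (PiM I N)"
    unfolding measurable_cong_sets[OF GM refl] by (rule measurable_prob_algebraD[OF K])
  have "emeasure (PiM I G \<bind> (\<lambda>z. \<Pi>\<^sub>M i\<in>I. \<kappa> i (z i))) (Pi\<^sub>E I A)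
    = (\<integral>\<^sup>+z. emeasure (\<Pi>\<^sub>M i\<in>I. \<kappa> i (z i)) (Pi\<^sub>E I A) \<partial>PiM I G)"
    using I A prob_space.not_empty[OF \<open>prob_space (PiM I G)\<close>] by (intro emeasure_bind[OF _ KG] sets_PiM_I_finite) auto
  also have "\<dots> = (\<integral>\<^sup>+z. (\<Prod>i\<in>I. emeasure (\<kappa> i (z i)) (A i)) \<partial>PiM I G)"
  proof (rule nn_integral_cong)
    fix z assume "z \<in> space (PiM I G)"
    then have zi: "z i \<in> space (M i)" if "i \<in> I" for i
      using that sets_eq_imp_space_eq[OF Gs[OF that]] by (auto simp: space_PiM)
    show "emeasure (\<Pi>\<^sub>M i\<in>I. \<kappa> i (z i)) (Pi\<^sub>E I A) = (\<Prod>i\<in>I. emeasure (\<kappa> i (z i)) (A i))"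
      by (rule emeasure_PiM_prob) (use I A prob_kernelD[OF \<kappa> zi] in auto)
  qed
  also have "\<dots> = (\<Prod>i\<in>I. \<integral>\<^sup>+x. emeasure (\<kappa> i x) (A i) \<partial>G i)"
  proof (rule nn_integral_PiM_prob_prod[OF I Gp])
    show "(\<lambda>x. emeasure (\<kappa> i x) (A i)) \<in> borel_measurable (G i)" if "i \<in> I" for i
      unfolding measurable_cong_sets[OF Gs[OF that] refl]
      by (rule emeasure_prob_kernel_measurable[OF \<kappa>[OF that] A[OF that]])
  qed
  also have "\<dots> = (\<Prod>i\<in>I. emeasure (G i \<bind> \<kappa> i) (A i))"
    by (intro prod.cong refl emeasure_bind[symmetric, OF _ \<kappa>G] A prob_space.not_empty[OF Gp])
  finally show "emeasure (PiM I G \<bind> (\<lambda>z. \<Pi>\<^sub>M i\<in>I. \<kappa> i (z i))) (Pi\<^sub>E I A) = (\<Prod>i\<in>I. emeasure (G i \<bind> \<kappa> i) (A i))" .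
qed

section \<open>From the Markov processes to the joint transition kernel\<close>

text \<open>The Markov property is used at time 0 only: there the process is almost surely
  \<open>z\<close>, so the conditional probability is a constant, and taking expectations turns it
  into the law at time \<open>t\<close>. Kernel uniqueness then exchanges the semigroup of the
  process for \<open>Q\<close>.\<close>

lemma cir_process_marginal:
  assumes Z: "cir_process \<alpha> \<beta> z M Z" and Q: "cir_semigroup \<alpha> \<beta> Q" and "\<beta> > 0" "z \<ge> 0" "t \<ge> 0"
  shows "Z t \<in> M \<rightarrow>\<^sub>M half_line" "distr M half_line (Z t) = Q t z"
proof -
  obtain P where P: "cir_semigroup \<alpha> \<beta> P" "markov_process M Z P" and Z0: "AE \<omega> in M. Z 0 \<omega> = z"
    using Z by (auto simp: cir_process_def)
  interpret prob_space M using P by (simp add: markov_process_def)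
  have Zm: "Z u \<in> M \<rightarrow>\<^sub>M half_line" if "u \<ge> 0" for u
    using P that by (simp add: markov_process_def)
  then show Zt: "Z t \<in> M \<rightarrow>\<^sub>M half_line" using assms by simp
  have "subalgebra M (history M Z 0)"
  proof -
    have "Z u -` A \<inter> space M \<in> sets M" if "u = 0" "A \<in> sets half_line" for u A
      using measurable_sets[OF Zm] that by simp
    then have "(\<Union>u\<in>{0..0}. {Z u -` A \<inter> space M | A. A \<in> sets half_line}) \<subseteq> sets M" by auto
    then show ?thesis
      unfolding subalgebra_def history_def
      using sets.sigma_sets_subset sets.space_closed by (auto simp: sets_measure_of_conv space_measure_of_conv)
  qed
  then interpret finite_measure_subalgebra M "history M Z 0" by unfold_locales
  have feller: "feller_semigroup P" using P by (simp add: cir_semigroup_def)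
  note Pz = feller_prob[OF feller assms(5,4)]
  have "distr M half_line (Z t) = P t z"
  proof (rule measure_eqI)
    fix A assume "A \<in> sets (distr M half_line (Z t))"
    then have A: "A \<in> sets half_line" by simp
    have ind: "integrable M (\<lambda>\<omega>. indicator A (Z t \<omega>) :: real)"
      using measurable_compose[OF Zt borel_measurable_indicator[OF A]]
      by (intro integrable_const_bound[of _ 1]) auto
    have "AE \<omega> in M. real_cond_exp M (history M Z 0) (\<lambda>\<omega>. indicator A (Z (0 + t) \<omega>)) \<omega> = measure (P t (Z 0 \<omega>)) A"
      using P(2)[unfolded markov_process_def] A assms(5) by blast
    then have "AE \<omega> in M. real_cond_exp M (history M Z 0) (\<lambda>\<omega>. indicator A (Z t \<omega>)) \<omega> = measure (P t z) A"
      using Z0 by eventually_elim simp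
    then have "(\<integral>\<omega>. real_cond_exp M (history M Z 0) (\<lambda>\<omega>. indicator A (Z t \<omega>)) \<omega> \<partial>M) = (\<integral>\<omega>. measure (P t z) A \<partial>M)"
      using real_cond_exp_int(1)[OF ind] by (intro integral_cong_AE) auto
    then have "(\<integral>\<omega>. indicator A (Z t \<omega>) \<partial>M) = measure (P t z) A"
      unfolding real_cond_exp_int(2)[OF ind] by (simp add: prob_space)
    moreover have "(\<integral>\<omega>. indicator A (Z t \<omega>) \<partial>M) = measure (distr M half_line (Z t)) A"
      using integral_distr[OF Zt, of "indicator A :: real \<Rightarrow> real"] A
        sets.sets_into_space[OF A] by (simp add: Int_absorb2)
    ultimately have "measure (distr M half_line (Z t)) A = measure (P t z) A" by simp
    moreover have "prob_space (distr M half_line (Z t))" using Zt by (rule prob_space_distr)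
    ultimately show "emeasure (distr M half_line (Z t)) A = emeasure (P t z) A"
      using Pz(1) by (simp add: finite_measure.emeasure_eq_measure prob_space_def)
  qed (use Pz in simp)
  then show "distr M half_line (Z t) = Q t z"
    using cir_kernel_unique[OF P(1) Q assms(3,5,4)] by simp
qed

lemma cir_processes_semigroup:
  assumes "independent_cir_processes K \<alpha> \<beta> M Z" "j \<in> {1..K}"
  shows "\<exists>Q. cir_semigroup (\<alpha> j) \<beta> Q"
proof -
  \<comment> \<open>Every starting point supplies a semigroup for each component; the zero vector is
    an explicit one.\<close>
  have "(\<lambda>j\<in>{1..K}. 0) \<in> space (orthant K)" by (simp add: space_orthant)
  then show ?thesis using assms by (fastforce simp: independent_cir_processes_def cir_process_def)
qed

text \<open>Independence of whole paths passes to time \<open>t\<close> because evaluation at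
  \<open>t\<close> is measurable on path space; the joint law is then the product of the
  marginals.\<close>

lemma transition_kernel_eq_PiM:
  assumes ind: "independent_cir_processes K \<alpha> \<beta> M Z" and "K \<ge> 1" "\<beta> > 0" "t \<ge> 0"
    and Q: "\<And>j. j \<in> {1..K} \<Longrightarrow> cir_semigroup (\<alpha> j) \<beta> (Q j)" and z: "z \<in> space (orthant K)"
  shows "transition_kernel K M Z t z = (\<Pi>\<^sub>M j\<in>{1..K}. Q j t (z j))"
proof -
  interpret prob_space "M z" using ind z by (simp add: independent_cir_processes_def)
  have Zj: "cir_process (\<alpha> j) \<beta> (z j) (M z) (Z j)" if "j \<in> {1..K}" for j
    using ind z that by (simp add: independent_cir_processes_def)
  have zj: "z j \<ge> 0" if "j \<in> {1..K}" for j using z that by (auto simp: space_orthant)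
  note marg = cir_process_marginal[OF Zj Q \<open>\<beta> > 0\<close> zj \<open>t \<ge> 0\<close>]
  have "indep_vars (\<lambda>_. \<Pi>\<^sub>M t\<in>{0..}. half_line) (\<lambda>j \<omega>. \<lambda>t\<in>{0..}. Z j t \<omega>) {1..K}"
    using ind z by (simp add: independent_cir_processes_def)
  then have "indep_vars (\<lambda>_. half_line) (\<lambda>j \<omega>. (\<lambda>t\<in>{0..}. Z j t \<omega>) t) {1..K}"
    by (rule indep_vars_compose2) (use \<open>t \<ge> 0\<close> in \<open>auto intro: measurable_component_singleton\<close>)
  then have "indep_vars (\<lambda>_. half_line) (\<lambda>j. Z j t) {1..K}" using \<open>t \<ge> 0\<close> by simp
  then have "distr (M z) (\<Pi>\<^sub>M j\<in>{1..K}. half_line) (\<lambda>\<omega>. \<lambda>j\<in>{1..K}. Z j t \<omega>) = (\<Pi>\<^sub>M j\<in>{1..K}. distr (M z) half_line (Z j t))"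
    using \<open>K \<ge> 1\<close> marg(1) by (subst (asm) indep_vars_iff_distr_eq_PiM') auto
  also have "\<dots> = (\<Pi>\<^sub>M j\<in>{1..K}. Q j t (z j))"
    by (rule PiM_cong) (use marg(2) in auto)
  finally show ?thesis by (simp add: transition_kernel_def orthant_def)
qed

section \<open>Combinatorics of the mixture weights\<close>

text \<open>The exponents of p and 1 - p add up to n - i and i, so these powers depend on
  \<open>l\<close> only through its sum. What is left is the product of the binomial coefficients;
  dividing it by \<open>n choose i\<close> gives the hypergeometric weight.\<close>

lemma prod_binomial_prob_eq_hypergeom:
  assumes n: "n = (\<Sum>j\<in>{1..K}. m j)" and l: "l \<in> subvectors K m i"
  shows "(\<Prod>j\<in>{1..K}. binomial_prob (m j - l j) (m j) p) = binomial_prob (n - i) n p * hypergeom_prob K l m i"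
proof -
  have le: "l j \<le> m j" if "j \<in> {1..K}" for j using l that by (auto simp: subvectors_def PiE_iff)
  have i: "i = (\<Sum>j\<in>{1..K}. l j)" using l by (simp add: subvectors_def)
  \<comment> \<open>Guarantees that \<open>n choose i\<close> is nonzero and can be cancelled
    below.\<close>
  have "i \<le> n" unfolding i n by (rule sum_mono) (rule le)
  have diff: "(\<Sum>j\<in>{1..K}. m j - l j) = n - i"
    unfolding i n by (rule sum_subtractf_nat) (rule le)
  have "(\<Prod>j\<in>{1..K}. binomial_prob (m j - l j) (m j) p)
      = (\<Prod>j\<in>{1..K}. real (m j choose l j) * p ^ (m j - l j) * (1 - p) ^ l j)"
    by (intro prod.cong refl binomial_prob_diff le)
  also have "\<dots> = (\<Prod>j\<in>{1..K}. real (m j choose l j)) * p ^ (n - i) * (1 - p) ^ i"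
    by (simp add: prod.distrib power_sum[symmetric] diff[simplified] i[symmetric, simplified])
  also have "\<dots> = binomial_prob (n - i) n p * hypergeom_prob K l m i"
    using \<open>i \<le> n\<close> by (simp add: binomial_prob_diff hypergeom_prob_def n[symmetric, simplified])
  finally show ?thesis .
qed

lemma sum_PiE_eq_sum_subvectors:
  fixes h :: "(nat \<Rightarrow> nat) \<Rightarrow> 'a :: comm_monoid_add"
  assumes "n = (\<Sum>j\<in>{1..K}. m j)"
  shows "(\<Sum>l\<in>(\<Pi>\<^sub>E j\<in>{1..K}. {0..m j}). h l) = (\<Sum>i\<in>{0..n}. \<Sum>l\<in>subvectors K m i. h l)"
proof -
  have "(\<lambda>l. \<Sum>j\<in>{1..K}. l j) ` (\<Pi>\<^sub>E j\<in>{1..K}. {0..m j}) \<subseteq> {0..n}"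
    unfolding assms by (auto simp: PiE_iff intro!: sum_mono)
  then show ?thesis
    unfolding subvectors_def by (subst sum.group) (auto intro: finite_PiE)
qed

theorem proposition4p2:
  fixes K :: nat and \<alpha> :: "nat \<Rightarrow> real" and \<beta> \<theta> :: real
    and M :: "(nat \<Rightarrow> real) \<Rightarrow> 'w measure" and Z :: "nat \<Rightarrow> real \<Rightarrow> 'w \<Rightarrow> real"
    and m :: "nat \<Rightarrow> nat" and n :: nat and s t :: real
  assumes "K \<ge> 2" and "\<beta> > 0" and "\<forall>j\<in>{1..K}. \<alpha> j > 0"
    and "\<theta> = (\<Sum>j\<in>{1..K}. \<alpha> j)"
    and "independent_cir_processes K \<alpha> \<beta> M Z"
    and "n = (\<Sum>j\<in>{1..K}. m j)"
    and "s \<ge> 0" and "t \<ge> 0"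
  shows "prediction K M Z t (gamma_product K (\<lambda>j. \<alpha> j + real (m j)) (\<beta> + s)) =
    mixture (orthant K) {0..n}
      (\<lambda>i. binomial_prob (n - i) n (p_coeff \<beta> s t))
      (\<lambda>i. gamma_times K (\<theta> + real n - real i) (\<beta> + S_coeff \<beta> s t)
        (mixture (orthant K) (subvectors K m i)
          (\<lambda>l. hypergeom_prob K l m i)
          (\<lambda>l. dirichlet K (\<lambda>j. \<alpha> j + real (m j) - real (l j)))))"
    (is "?lhs = ?rhs")
proof -
  let ?p = "p_coeff \<beta> s t" and ?b = "\<beta> + S_coeff \<beta> s t"
  have \<alpha>: "\<alpha> j > 0" if "j \<in> {1..K}" for j using assms(3) that by simp
  have K: "K \<ge> 1" using assms(1) by simp
  note p = p_coeff_bounds[OF assms(2,7,8)]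
  have b: "?b > 0" using assms p by (simp add: S_coeff_eq add_pos_nonneg)
  obtain Q where Q: "\<And>j. j \<in> {1..K} \<Longrightarrow> cir_semigroup (\<alpha> j) \<beta> (Q j)"
    using cir_processes_semigroup[OF assms(5)] by metis
  have Qm: "Q j t \<in> half_line \<rightarrow>\<^sub>M prob_algebra half_line" if "j \<in> {1..K}" for j
    using Q[OF that] assms(8) by (intro feller_prob_algebra) (simp_all add: cir_semigroup_def)
  define G where "G j = gamma_dist (\<alpha> j + real (m j)) (\<beta> + s)" for j
  define H where "H j = G j \<bind> Q j t" for j
  have G: "G j \<in> space (prob_algebra half_line)" if "j \<in> {1..K}" for j
    unfolding G_def using \<alpha>[OF that] assms by (intro gamma_dist_in_prob_algebra) auto
  have sH: "sets (H j) = sets half_line" and pH: "prob_space (H j)" if "j \<in> {1..K}" for j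
    unfolding H_def by (rule sets_bind'[OF G[OF that] Qm[OF that]], rule prob_space_bind'[OF G[OF that] Qm[OF that]])
  have H: "H j = mixture half_line {0..m j} (\<lambda>k. binomial_prob (m j - k) (m j) ?p) (\<lambda>k. gamma_dist (\<alpha> j + real (m j) - real k) ?b)"
    if "j \<in> {1..K}" for j
    unfolding H_def G_def by (rule gamma_dist_bind_cir[OF Q[OF that] \<alpha>[OF that] assms(2,7,8)])
  have "sets (PiM {1..K} G) = sets (orthant K)"
    unfolding orthant_def by (rule sets_PiM_cong) (auto simp: G_def)
  then have sp: "space (PiM {1..K} G) = space (orthant K)" by (rule sets_eq_imp_space_eq)
  \<comment> \<open>The kernels agree on the orthant, which is the whole space of the initial law,
    so the bind is unchanged.\<close>
  have "?lhs = PiM {1..K} G \<bind> (\<lambda>z. \<Pi>\<^sub>M j\<in>{1..K}. Q j t (z j))"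
    unfolding prediction_def gamma_product_def G_def[symmetric]
    by (rule bind_cong[OF refl]) (rule transition_kernel_eq_PiM[OF assms(5) K assms(2,8) Q, unfolded sp[symmetric]])
  also have "\<dots> = PiM {1..K} H"
    unfolding H_def by (rule bind_PiM_kernel[OF _ Qm G]) auto
  also have "\<dots> = ?rhs"
  \<comment> \<open>A product of probability measures is determined by its values on boxes, so the
    mixture is evaluated on boxes only.\<close>
  proof (rule PiM_prob_eqI[symmetric, OF _ pH])
    show "sets ?rhs = sets (PiM {1..K} H)"
      unfolding sets_mixture orthant_def by (rule sets_PiM_cong) (auto simp: sH)
    fix B assume "\<And>j. j \<in> {1..K} \<Longrightarrow> B j \<in> sets (H j)"
    then have B: "B j \<in> sets half_line" if "j \<in> {1..K}" for j using sH that by auto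
    have PB: "Pi\<^sub>E {1..K} B \<in> sets (orthant K)"
      unfolding orthant_def by (rule sets_PiM_I_finite) (use B in auto)
    define g where "g l = (\<Prod>j\<in>{1..K}. emeasure (gamma_dist (\<alpha> j + real (m j) - real (l j)) ?b) (B j))" for l
    have fin: "finite (subvectors K m i)" for i
      unfolding subvectors_def by (rule finite_subset[OF _ finite_PiE[of "{1..K}" "\<lambda>j. {0..m j}"]]) auto
    have hyp: "hypergeom_prob K l m i \<ge> 0" for l i
      by (simp add: hypergeom_prob_def prod_nonneg)
    have "emeasure ?rhs (Pi\<^sub>E {1..K} B) = (\<Sum>i\<in>{0..n}. ennreal (binomial_prob (n - i) n ?p) *
        (\<Sum>l\<in>subvectors K m i. ennreal (hypergeom_prob K l m i) * g l))"
    proof (subst emeasure_mixture[OF _ PB], simp add: gamma_times_def, intro sum.cong refl arg_cong2[where f = "(*)"])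
      fix i assume "i \<in> {0..n}"
      have le: "l j \<le> m j" if "l \<in> subvectors K m i" "j \<in> {1..K}" for l j
        using that by (auto simp: subvectors_def PiE_iff)
      show "emeasure (gamma_times K (\<theta> + real n - real i) ?b (mixture (orthant K) (subvectors K m i)
          (\<lambda>l. hypergeom_prob K l m i) (\<lambda>l. dirichlet K (\<lambda>j. \<alpha> j + real (m j) - real (l j))))) (Pi\<^sub>E {1..K} B)
        = (\<Sum>l\<in>subvectors K m i. ennreal (hypergeom_prob K l m i) * g l)"
        unfolding g_def
      proof (rule emeasure_gamma_times_mixture_dirichlet[OF K b fin])
        fix l assume l: "l \<in> subvectors K m i"
        show "\<alpha> j + real (m j) - real (l j) > 0" if "j \<in> {1..K}" for j
          using \<alpha>[OF that] le[OF l that] by simp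
        \<comment> \<open>The parameter sum is constant on \<open>subvectors K m i\<close>; hence
          the radial law depends on \<open>i\<close> alone and can stand in front of the inner
          mixture.\<close>
        have "(\<Sum>j\<in>{1..K}. l j) = i" using l by (simp add: subvectors_def)
        then show "(\<Sum>j\<in>{1..K}. \<alpha> j + real (m j) - real (l j)) = \<theta> + real n - real i"
          unfolding assms(4,6) by (simp only: sum.distrib sum_subtractf of_nat_sum[symmetric])
      qed (rule B)
    qed
    also have "\<dots> = (\<Sum>i\<in>{0..n}. \<Sum>l\<in>subvectors K m i. ennreal (\<Prod>j\<in>{1..K}. binomial_prob (m j - l j) (m j) ?p) * g l)"
      unfolding sum_distrib_left
      by (intro sum.cong refl)
        (simp add: prod_binomial_prob_eq_hypergeom[OF assms(6), simplified] ennreal_mult binomial_prob_nonneg p hyp mult.assoc)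
    also have "\<dots> = (\<Sum>l\<in>(\<Pi>\<^sub>E j\<in>{1..K}. {0..m j}). ennreal (\<Prod>j\<in>{1..K}. binomial_prob (m j - l j) (m j) ?p) * g l)"
      by (rule sum_PiE_eq_sum_subvectors[OF assms(6), symmetric])
    also have "\<dots> = (\<Sum>l\<in>(\<Pi>\<^sub>E j\<in>{1..K}. {0..m j}). \<Prod>j\<in>{1..K}. ennreal (binomial_prob (m j - l j) (m j) ?p)
        * emeasure (gamma_dist (\<alpha> j + real (m j) - real (l j)) ?b) (B j))"
      by (simp add: g_def prod.distrib prod_ennreal binomial_prob_nonneg p)
    \<comment> \<open>Distributivity read backwards: a vector \<open>l\<close> selects one summand
      \<open>k = l j\<close> in each coordinate.\<close>
    also have "\<dots> = (\<Prod>j\<in>{1..K}. \<Sum>k\<in>{0..m j}. ennreal (binomial_prob (m j - k) (m j) ?p)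
        * emeasure (gamma_dist (\<alpha> j + real (m j) - real k) ?b) (B j))"
      by (rule prod_sum_PiE[symmetric]) auto
    also have "\<dots> = (\<Prod>j\<in>{1..K}. emeasure (H j) (B j))"
      by (intro prod.cong refl) (simp only: H, rule emeasure_mixture[symmetric, OF _ B], auto)
    finally show "emeasure ?rhs (Pi\<^sub>E {1..K} B) = (\<Prod>j\<in>{1..K}. emeasure (H j) (B j))" .
  qed simp
  finally show ?thesis .
qed

end
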